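(* Let $1\le p<\infty$ and let $X$ be a Banach space. In each of the following three versions (a), (b), (c) separately, the statements (i), (ii), (iii) are equivalent. (a) Weakly precompact version: (i) For every Banach space $Y$, if $T:Y\to X$ is an operator such that $T^*:X^*\to Y^*$ is $p$-convergent, then $T$ is weakly precompact. (ii) The same as (i) with $Y=\ell_1$. (iii) Every weakly-$p$-Dunford-Pettis subset of $X$ is weakly precompact. (b) Weakly compact version: (i) For every Banach space $Y$, if $T:Y\to X$ is an operator such that $T^*:X^*\to Y^*$ is $p$-convergent, then $T$ is weakly compact. (ii) The same as (i) with $Y=\ell_1$. (iii) Every weakly-$p$-Dunford-Pettis subset of $X$ is relatively weakly compact. (c) Compact version: (i) For every Banach space $Y$, if $T:Y\to X$ is an operator such that $T^*:X^*\to Y^*$ is $p$-convergent, then $T$ is compact. (ii) The same as (i) with $Y=\ell_1$. (iii) Every weakly-$p$-Dunford-Pettis subset of $X$ is relatively compact.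
   Context: Operators are continuous linear maps between Banach spaces. A sequence $(x_n)$ in a Banach space $E$ is weakly $p$-summable if $(x^*(x_n))_n\in\ell_p$ for every $x^*\in E^*$. An operator is $p$-convergent if it maps weakly $p$-summable sequences to norm null sequences. A bounded subset $A$ of $X$ is a weakly-$p$-Dunford-Pettis set if $\sup_{x\in A}|x_n^*(x)|\to 0$ for every weakly $p$-summable sequence $(x_n^* )$ in $X^*$. A subset $S$ of $X$ is weakly precompact if every sequence from $S$ has a weakly Cauchy subsequence; an operator $T:Y\to X$ is weakly precompact if the image $T(B_Y)$ of the unit ball is weakly precompact. (Version (b)(iii) is what the paper calls property $RDP_p^*$ of $X$.) *)

theory Defs
  imports "HOL-Analysis.Analysis"
begin

section \<open>Banach spaces as first-class objects\<close>

text \<open>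
  A quantifier over all Banach spaces \<open>Y\<close> inside a formula cannot be expressed through the type
  class \<^class>\<open>banach\<close>, so the spaces that are quantified over are real Banach spaces whose
  underlying set is a subset \<open>vcarrier Y\<close> of some type; the values of the operations off the
  carrier are irrelevant.
\<close>

record 'a normed_str =
  vcarrier :: "'a set"
  vadd :: "'a \<Rightarrow> 'a \<Rightarrow> 'a"
  vzero :: 'a
  vscale :: "real \<Rightarrow> 'a \<Rightarrow> 'a"
  vnorm :: "'a \<Rightarrow> real"

text \<open>The locale \<^locale>\<open>Metric_space\<close> asks for nonnegativity and symmetry off the carrier too.\<close>

definition vdist :: "'a normed_str \<Rightarrow> 'a \<Rightarrow> 'a \<Rightarrow> real" where
  "vdist Y x y = (if x \<in> vcarrier Y \<and> y \<in> vcarrier Y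
     then vnorm Y (vadd Y x (vscale Y (-1) y)) else 0)"

definition unit_ball :: "'a normed_str \<Rightarrow> 'a set" where
  "unit_ball Y = {y \<in> vcarrier Y. vnorm Y y \<le> 1}"

locale banach_str =
  fixes Y :: "'a normed_str"
  assumes zero_closed: "vzero Y \<in> vcarrier Y"
    and add_closed: "\<lbrakk>x \<in> vcarrier Y; y \<in> vcarrier Y\<rbrakk> \<Longrightarrow> vadd Y x y \<in> vcarrier Y"
    and scale_closed: "x \<in> vcarrier Y \<Longrightarrow> vscale Y r x \<in> vcarrier Y"
    and add_assoc: "\<lbrakk>x \<in> vcarrier Y; y \<in> vcarrier Y; z \<in> vcarrier Y\<rbrakk>
      \<Longrightarrow> vadd Y (vadd Y x y) z = vadd Y x (vadd Y y z)"
    and add_commute: "\<lbrakk>x \<in> vcarrier Y; y \<in> vcarrier Y\<rbrakk> \<Longrightarrow> vadd Y x y = vadd Y y x"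
    and add_zero: "x \<in> vcarrier Y \<Longrightarrow> vadd Y x (vzero Y) = x"
    and add_inverse: "x \<in> vcarrier Y \<Longrightarrow> \<exists>y\<in>vcarrier Y. vadd Y x y = vzero Y"
    and scale_add_right: "\<lbrakk>x \<in> vcarrier Y; y \<in> vcarrier Y\<rbrakk>
      \<Longrightarrow> vscale Y r (vadd Y x y) = vadd Y (vscale Y r x) (vscale Y r y)"
    and scale_add_left: "x \<in> vcarrier Y
      \<Longrightarrow> vscale Y (r + s) x = vadd Y (vscale Y r x) (vscale Y s x)"
    and scale_scale: "x \<in> vcarrier Y \<Longrightarrow> vscale Y r (vscale Y s x) = vscale Y (r * s) x"
    and scale_one: "x \<in> vcarrier Y \<Longrightarrow> vscale Y 1 x = x"
    and norm_eq_zero: "x \<in> vcarrier Y \<Longrightarrow> vnorm Y x = 0 \<longleftrightarrow> x = vzero Y"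
    and norm_scale: "x \<in> vcarrier Y \<Longrightarrow> vnorm Y (vscale Y r x) = \<bar>r\<bar> * vnorm Y x"
    and norm_triangle: "\<lbrakk>x \<in> vcarrier Y; y \<in> vcarrier Y\<rbrakk>
      \<Longrightarrow> vnorm Y (vadd Y x y) \<le> vnorm Y x + vnorm Y y"
    and complete: "Metric_space.mcomplete (vcarrier Y) (vdist Y)"

definition operator_from :: "'a normed_str \<Rightarrow> ('a \<Rightarrow> 'b::real_normed_vector) \<Rightarrow> bool" where
  "operator_from Y T \<longleftrightarrow>
     (\<forall>x\<in>vcarrier Y. \<forall>y\<in>vcarrier Y. T (vadd Y x y) = T x + T y) \<and>
     (\<forall>r. \<forall>x\<in>vcarrier Y. T (vscale Y r x) = r *\<^sub>R T x) \<and>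
     (\<exists>K. \<forall>x\<in>vcarrier Y. norm (T x) \<le> K * vnorm Y x)"

text \<open>
  Functionals are normalised to vanish off the carrier, so that equality of functionals on
  \<open>vcarrier Y\<close> is equality of functions.
\<close>

definition dual_str :: "'a normed_str \<Rightarrow> ('a \<Rightarrow> real) normed_str" where
  "dual_str Y =
    \<lparr>vcarrier = {f. operator_from Y f \<and> (\<forall>y. y \<notin> vcarrier Y \<longrightarrow> f y = 0)},
     vadd = (\<lambda>f g y. f y + g y),
     vzero = (\<lambda>y. 0),
     vscale = (\<lambda>r f y. r * f y),
     vnorm = (\<lambda>f. SUP y\<in>unit_ball Y. \<bar>f y\<bar>)\<rparr>"

text \<open>
  The adjoint \<open>T\<^sup>* : X\<^sup>* \<rightarrow> Y\<^sup>*\<close> of \<open>T : Y \<rightarrow> X\<close>, where \<open>X\<^sup>*\<close> is the type of bounded linear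
  functionals on \<open>X\<close> and \<open>Y\<^sup>*\<close> is \<^const>\<open>dual_str\<close> \<open>Y\<close>.
\<close>

definition adjoint_op ::
    "'a normed_str \<Rightarrow> ('a \<Rightarrow> 'b::real_normed_vector) \<Rightarrow> ('b \<Rightarrow>\<^sub>L real) \<Rightarrow> ('a \<Rightarrow> real)" where
  "adjoint_op Y T f = (\<lambda>y. if y \<in> vcarrier Y then blinfun_apply f (T y) else 0)"

definition ell1 :: "(nat \<Rightarrow> real) normed_str" where
  "ell1 =
    \<lparr>vcarrier = {a. summable (\<lambda>n. \<bar>a n\<bar>)},
     vadd = (\<lambda>a b n. a n + b n),
     vzero = (\<lambda>n. 0),
     vscale = (\<lambda>r a n. r * a n),
     vnorm = (\<lambda>a. \<Sum>n. \<bar>a n\<bar>)\<rparr>"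

section \<open>Summability and the classes of operators and sets\<close>

definition weakly_p_summable :: "real \<Rightarrow> (nat \<Rightarrow> 'e::real_normed_vector) \<Rightarrow> bool" where
  "weakly_p_summable p x \<longleftrightarrow>
     (\<forall>f :: 'e \<Rightarrow>\<^sub>L real. summable (\<lambda>n. \<bar>blinfun_apply f (x n)\<bar> powr p))"

definition p_convergent ::
    "real \<Rightarrow> 'b normed_str \<Rightarrow> ('e::real_normed_vector \<Rightarrow> 'b) \<Rightarrow> bool" where
  "p_convergent p F S \<longleftrightarrow>
     (\<forall>x. weakly_p_summable p x \<longrightarrow> (\<lambda>n. vnorm F (S (x n))) \<longlonglongrightarrow> 0)"

text \<open>The supremum is taken in \<^typ>\<open>ennreal\<close>, so that it is \<open>0\<close> for the empty set.\<close>

definition weakly_p_DP_set :: "real \<Rightarrow> 'b::real_normed_vector set \<Rightarrow> bool" where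
  "weakly_p_DP_set p A \<longleftrightarrow> bounded A \<and>
     (\<forall>f :: nat \<Rightarrow> ('b \<Rightarrow>\<^sub>L real). weakly_p_summable p f \<longrightarrow>
        (\<lambda>n. SUP x\<in>A. ennreal \<bar>blinfun_apply (f n) x\<bar>) \<longlonglongrightarrow> 0)"

definition weakly_Cauchy :: "(nat \<Rightarrow> 'b::real_normed_vector) \<Rightarrow> bool" where
  "weakly_Cauchy x \<longleftrightarrow> (\<forall>f :: 'b \<Rightarrow>\<^sub>L real. Cauchy (\<lambda>n. blinfun_apply f (x n)))"

definition weakly_precompact :: "'b::real_normed_vector set \<Rightarrow> bool" where
  "weakly_precompact S \<longleftrightarrow>
     (\<forall>s :: nat \<Rightarrow> 'b. (\<forall>n. s n \<in> S) \<longrightarrow>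
        (\<exists>r :: nat \<Rightarrow> nat. strict_mono r \<and> weakly_Cauchy (s \<circ> r)))"

definition weak_topology :: "'b::real_normed_vector topology" where
  "weak_topology =
     topology_generated_by {blinfun_apply f -` U |(f :: 'b \<Rightarrow>\<^sub>L real) U. open U}"

definition relatively_weakly_compact :: "'b::real_normed_vector set \<Rightarrow> bool" where
  "relatively_weakly_compact S \<longleftrightarrow> compactin weak_topology (weak_topology closure_of S)"

definition relatively_compact :: "'b::real_normed_vector set \<Rightarrow> bool" where
  "relatively_compact S \<longleftrightarrow> compact (closure S)"

definition weakly_precompact_op ::
    "'a normed_str \<Rightarrow> ('a \<Rightarrow> 'b::real_normed_vector) \<Rightarrow> bool" where
  "weakly_precompact_op Y T \<longleftrightarrow> weakly_precompact (T ` unit_ball Y)"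

definition weakly_compact_op ::
    "'a normed_str \<Rightarrow> ('a \<Rightarrow> 'b::real_normed_vector) \<Rightarrow> bool" where
  "weakly_compact_op Y T \<longleftrightarrow> relatively_weakly_compact (T ` unit_ball Y)"

definition compact_op ::
    "'a normed_str \<Rightarrow> ('a \<Rightarrow> 'b::real_normed_vector) \<Rightarrow> bool" where
  "compact_op Y T \<longleftrightarrow> relatively_compact (T ` unit_ball Y)"

end

theory Submission
  imports Defs
begin

text \<open>
  If \<open>T\<^sup>*\<close> is \<open>p\<close>-convergent, then \<open>T(B\<^sub>Y)\<close> is a weakly-\<open>p\<close>-Dunford-Pettis set, because
  \<open>\<bar>f(T y)\<bar> \<le> \<parallel>T\<^sup>* f\<parallel>\<close> on the unit ball. Conversely, a sequence \<open>(s\<^sub>n)\<close> in such a set \<open>A\<close> is the image of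
  the unit vectors under \<open>T a = \<Sum> a\<^sub>n s\<^sub>n\<close> on \<open>\<ell>\<^sub>1\<close>, and \<open>\<parallel>T\<^sup>* f\<parallel> = sup \<bar>f(s\<^sub>n)\<bar>\<close>, so \<open>T\<^sup>*\<close> is
  \<open>p\<close>-convergent. Hence it suffices that the three kinds of compactness of \<open>A\<close> are determined by the
  sequences in \<open>A\<close>. For weak compactness this is Eberlein's theorem: if a weak-star limit \<open>z\<close> of points of
  \<open>A\<close> in the bidual has distance more than \<open>d > 0\<close> to \<open>X\<close>, choose alternately functionals \<open>f\<^sub>n\<close> of norm at
  most \<open>1\<close> and \<open>s\<^sub>n \<in> A\<close> with \<open>f\<^sub>n(s\<^sub>i) = 0\<close> for \<open>i < n\<close> and \<open>f\<^sub>i(s\<^sub>n) > d\<close> for \<open>i \<le> n\<close>; a weak cluster point \<open>x\<close> of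
  \<open>(s\<^sub>n)\<close> lies in the closed span of the \<open>s\<^sub>n\<close>, so \<open>f\<^sub>n(x) \<rightarrow> 0\<close>, although \<open>f\<^sub>n(x) \<ge> d\<close> for all \<open>n\<close>.
\<close>

section \<open>Hahn-Banach through minimal sublinear functionals, with norming and separating
  functionals\<close>

section \<open>The Hahn--Banach theorem\<close>

text \<open>Homogeneity is asked only as an inequality, which is easier to check for infima; scaling
  back by \<open>inverse t\<close> gives equality in \<open>sublinear_scale\<close>.\<close>

definition sublinear :: "('v::real_vector \<Rightarrow> real) \<Rightarrow> bool" where
  "sublinear q \<longleftrightarrow> (\<forall>x y. q (x + y) \<le> q x + q y) \<and> (\<forall>t\<ge>0. \<forall>x. q (t *\<^sub>R x) \<le> t * q x)"

lemma sublinear_add: "sublinear q \<Longrightarrow> q (x + y) \<le> q x + q y"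
  by (simp add: sublinear_def)

lemma sublinear_scale_le: "sublinear q \<Longrightarrow> 0 \<le> t \<Longrightarrow> q (t *\<^sub>R x) \<le> t * q x"
  by (simp add: sublinear_def)

lemma sublinear_0:
  assumes "sublinear q"
  shows "q 0 = 0"
  using sublinear_add[OF assms, of 0 0] sublinear_scale_le[OF assms, of 0 0] by simp

lemma sublinear_scale:
  assumes q: "sublinear q" and t: "0 \<le> t"
  shows "q (t *\<^sub>R x) = t * q x"
proof (cases "t = 0")
  case True
  then show ?thesis using q by (simp add: sublinear_0)
next
  case False
  then have "t * q x \<le> q (t *\<^sub>R x)"
    using sublinear_scale_le[OF q, of "inverse t" "t *\<^sub>R x"] t by (simp add: field_simps)
  then show ?thesis
    using sublinear_scale_le[OF q t, of x] by simp
qed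

lemma sublinear_neg: "sublinear q \<Longrightarrow> - q (- x) \<le> q x"
  using sublinear_add[of q x "- x"] sublinear_0[of q] by simp

text \<open>Zorn's lemma applied downwards: the pointwise infimum of a chain below \<open>p\<close>
  is again sublinear, and it is finite because every member satisfies
  \<open>- p (- x) \<le> q x\<close>.\<close>

lemma exists_minimal_sublinear:
  fixes p :: "'v::real_vector \<Rightarrow> real"
  assumes p: "sublinear p"
  shows "\<exists>m. sublinear m \<and> m \<le> p \<and> (\<forall>q. sublinear q \<longrightarrow> q \<le> m \<longrightarrow> q = m)"
proof -
  define A where "A = {q. sublinear q \<and> q \<le> p}"
  have "\<exists>m\<in>A. \<forall>q\<in>A. q \<le> m \<longrightarrow> q = m"
  \<comment> \<open>The order is reversed, so that a maximal element is a minimal sublinear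
    function.\<close>
  proof (rule predicate_Zorn)
    show "partial_order_on A (relation_of (\<lambda>a b. b \<le> a) A)"
      by (auto simp: partial_order_on_def preorder_on_def refl_on_def trans_def antisym_def relation_of_def)
    fix C assume C: "C \<in> Chains (relation_of (\<lambda>a b. b \<le> a) A)"
    show "\<exists>u\<in>A. \<forall>a\<in>C. u \<le> a"
    proof (cases "C = {}")
      case True
      then show ?thesis using p by (auto simp: A_def)
    next
      case False
      have CA: "C \<subseteq> A" and total: "\<And>q r. q \<in> C \<Longrightarrow> r \<in> C \<Longrightarrow> q \<le> r \<or> r \<le> q"
        using C unfolding Chains_def relation_of_def by auto
      define u where "u x = (INF q\<in>C. q x)" for x
      have bdd: "bdd_below ((\<lambda>q. q x) ` C)" for x
      proof (rule bdd_belowI2)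
        fix q assume "q \<in> C"
        then have "sublinear q" "q (- x) \<le> p (- x)" using CA by (auto simp: A_def le_fun_def)
        then show "- p (- x) \<le> q x" using sublinear_neg[of q x] by linarith
      qed
      have u_le: "u x \<le> q x" if "q \<in> C" for q x
        unfolding u_def using bdd that by (rule cINF_lower)
      have u_ge: "b \<le> u x" if "\<And>q. q \<in> C \<Longrightarrow> b \<le> q x" for b x
        unfolding u_def using False that by (rule cINF_greatest)
      \<comment> \<open>The two summands may be estimated by different members of the chain, since
        the smaller of the two serves for both. The infima over \<open>q\<close> and
        \<open>r\<close> are then taken one after the other.\<close>
      have *: "u (x + y) \<le> q x + r y" if qr: "q \<in> C" "r \<in> C" for x y q r
      proof -
        obtain s where s: "s \<in> C" "s \<le> q" "s \<le> r" using total[OF qr] qr by blast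
        have "u (x + y) \<le> s (x + y)" using s(1) by (rule u_le)
        also have "\<dots> \<le> s x + s y" using s CA by (auto simp: A_def sublinear_add)
        also have "\<dots> \<le> q x + r y" using s by (simp add: add_mono le_funD)
        finally show ?thesis .
      qed
      have **: "u (x + y) - r y \<le> u x" if r: "r \<in> C" for x y r
      proof (rule u_ge)
        fix q assume "q \<in> C"
        then show "u (x + y) - r y \<le> q x" using *[of q r x y] r by simp
      qed
      have "u (x + y) - u x \<le> u y" for x y
      proof (rule u_ge)
        fix r assume "r \<in> C"
        then show "u (x + y) - u x \<le> r y" using **[of r x y] by simp
      qed
      then have add: "u (x + y) \<le> u x + u y" for x y by (simp add: algebra_simps)
      have "u (t *\<^sub>R x) \<le> t * u x" if t: "t \<ge> 0" for t x
      proof -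
        have *: "u (t *\<^sub>R x) \<le> t * q x" if "q \<in> C" for q
          using u_le[OF that, of "t *\<^sub>R x"] sublinear_scale[of q t x] that CA t by (auto simp: A_def)
        show ?thesis
        proof (cases "t = 0")
          case True
          then show ?thesis using * False by auto
        next
          case False
          then have "u (t *\<^sub>R x) / t \<le> u x"
            using t * by (intro u_ge) (simp add: field_simps)
          then show ?thesis using False t by (simp add: field_simps)
        qed
      qed
      with add have "sublinear u" by (simp add: sublinear_def)
      moreover have "u \<le> p"
      proof -
        obtain q where "q \<in> C" using False by blast
        then have "u \<le> q" "q \<le> p" using CA u_le by (auto simp: A_def intro: le_funI)
        then show ?thesis by (rule order_trans)
      qed
      ultimately show ?thesis using u_le by (auto simp: A_def le_fun_def)
    qed
  qed
  then obtain m where m: "m \<in> A" "\<And>q. q \<in> A \<Longrightarrow> q \<le> m \<Longrightarrow> q = m"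
    by blast
  have "q = m" if "sublinear q" "q \<le> m" for q
    using m that order_trans[of q m p] by (auto simp: A_def)
  with m(1) show ?thesis by (auto simp: A_def)
qed

text \<open>The function \<open>q\<close> below is a sublinear minorant of \<open>m\<close>, so minimality forces \<open>q = m\<close>,
  which gives superadditivity at \<open>a\<close>.\<close>

lemma minimal_sublinear_linear:
  assumes m: "sublinear m" and min: "\<And>q. sublinear q \<Longrightarrow> q \<le> m \<Longrightarrow> q = m"
  shows "linear m"
proof -
  have ge: "m x + m a \<le> m (x + a)" for x a
  proof -
    define q where "q x = (INF t\<in>{0..}. m (x + t *\<^sub>R a) - t * m a)" for x
    have bdd: "bdd_below ((\<lambda>t. m (x + t *\<^sub>R a) - t * m a) ` {0..})" for x
    proof (rule bdd_belowI2)
      fix t :: real assume "t \<in> {0..}"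
      \<comment> \<open>Subadditivity is applied to
        \<open>t *\<^sub>R a = (x + t *\<^sub>R a) + (- x)\<close>.\<close>
      then have "t * m a \<le> m (x + t *\<^sub>R a) + m (- x)"
        using sublinear_scale[OF m, of t a] sublinear_add[OF m, of "x + t *\<^sub>R a" "- x"] by simp
      then show "- m (- x) \<le> m (x + t *\<^sub>R a) - t * m a" by simp
    qed
    have q_le: "q x \<le> m (x + t *\<^sub>R a) - t * m a" if "t \<ge> 0" for t x
      unfolding q_def using bdd that by (intro cINF_lower) auto
    have q_ge: "b \<le> q x" if "\<And>t. t \<ge> 0 \<Longrightarrow> b \<le> m (x + t *\<^sub>R a) - t * m a" for b x
      unfolding q_def using that by (intro cINF_greatest) auto
    have "q (x + y) \<le> (m (x + s *\<^sub>R a) - s * m a) + (m (y + t *\<^sub>R a) - t * m a)"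
      if "s \<ge> 0" "t \<ge> 0" for x y s t
      using q_le[of "s + t" "x + y"] sublinear_add[OF m, of "x + s *\<^sub>R a" "y + t *\<^sub>R a"] that
      by (simp add: algebra_simps)
    then have "q (x + y) - (m (y + t *\<^sub>R a) - t * m a) \<le> q x" if "t \<ge> 0" for x y t
      using that by (intro q_ge) (simp only: diff_le_eq)
    then have "q (x + y) - q x \<le> q y" for x y
      by (intro q_ge) (simp add: algebra_simps)
    then have add: "q (x + y) \<le> q x + q y" for x y by (simp add: algebra_simps)
    have "q (c *\<^sub>R x) \<le> c * q x" if c: "c \<ge> 0" for c x
    proof (cases "c = 0")
      case True
      then show ?thesis using q_le[of 0 0] sublinear_0[OF m] by simp
    next
      case False
      have "q (c *\<^sub>R x) \<le> c * (m (x + t *\<^sub>R a) - t * m a)" if "t \<ge> 0" for t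
        using q_le[of "c * t" "c *\<^sub>R x"] sublinear_scale[OF m, of c "x + t *\<^sub>R a"] that c
        by (simp add: algebra_simps)
      then have "q (c *\<^sub>R x) / c \<le> q x"
        using False c by (intro q_ge) (simp add: field_simps)
      then show ?thesis using False c by (simp add: field_simps)
    qed
    with add have "sublinear q" by (simp add: sublinear_def)
    moreover have "q \<le> m" using q_le[of 0] by (simp add: le_fun_def)
    ultimately have "q = m" by (rule min)
    then show ?thesis using q_le[of 1 x] by simp
  qed
  have add: "m (x + y) = m x + m y" for x y
    using ge sublinear_add[OF m] by (simp add: order_antisym)
  have neg: "m (- x) = - m x" for x
    using add[of x "- x"] sublinear_0[OF m] by simp
  have "m (c *\<^sub>R x) = c * m x" for c x
  proof (cases "c \<ge> 0")
    case True
    then show ?thesis using sublinear_scale[OF m] by simp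
  next
    case False
    then have "m ((- c) *\<^sub>R x) = - c * m x" using sublinear_scale[OF m, of "- c"] by simp
    then show ?thesis using neg[of "c *\<^sub>R x"] by simp
  qed
  with add show ?thesis by (intro linearI) simp_all
qed

text \<open>The function \<open>q x = inf (C * norm (x - m) + h m)\<close> over \<open>m\<close> in
  \<open>M\<close> is sublinear, at most \<open>C * norm x\<close> (take \<open>m = 0\<close>) and
  at most \<open>h\<close> on \<open>M\<close> (take \<open>m = x\<close>). A minimal sublinear
  function below \<open>q\<close> is linear; being below \<open>h\<close> at both \<open>x\<close>
  and \<open>- x\<close>, it agrees with \<open>h\<close> on \<open>M\<close>.\<close>

theorem hahn_banach:
  fixes h :: "'v::real_normed_vector \<Rightarrow> real"
  assumes M: "subspace M"
    and add: "\<And>x y. x \<in> M \<Longrightarrow> y \<in> M \<Longrightarrow> h (x + y) = h x + h y"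
    and scale: "\<And>c x. x \<in> M \<Longrightarrow> h (c *\<^sub>R x) = c * h x"
    and bound: "\<And>x. x \<in> M \<Longrightarrow> \<bar>h x\<bar> \<le> C * norm x"
    and C: "0 \<le> C"
  shows "\<exists>g :: 'v \<Rightarrow>\<^sub>L real. (\<forall>x\<in>M. blinfun_apply g x = h x) \<and> (\<forall>x. \<bar>blinfun_apply g x\<bar> \<le> C * norm x)"
proof -
  have M0: "0 \<in> M" and Madd: "\<And>x y. x \<in> M \<Longrightarrow> y \<in> M \<Longrightarrow> x + y \<in> M"
    and Mscale: "\<And>c x. x \<in> M \<Longrightarrow> c *\<^sub>R x \<in> M"
    using M by (auto simp: subspace_def)
  have h0: "h 0 = 0" using scale[OF M0, of 0] by simp
  define q where "q x = (INF m\<in>M. C * norm (x - m) + h m)" for x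
  have bdd: "bdd_below ((\<lambda>m. C * norm (x - m) + h m) ` M)" for x
  proof (rule bdd_belowI2)
    fix m assume "m \<in> M"
    then have "- h m \<le> C * norm m" using bound[of m] by linarith
    also have "\<dots> \<le> C * (norm (x - m) + norm x)"
      using C norm_triangle_ineq2[of m x] by (intro mult_left_mono) (auto simp: norm_minus_commute)
    finally show "- (C * norm x) \<le> C * norm (x - m) + h m" by (simp add: algebra_simps)
  qed
  have q_le: "q x \<le> C * norm (x - m) + h m" if "m \<in> M" for m x
    unfolding q_def using bdd that by (rule cINF_lower)
  have q_ge: "b \<le> q x" if "\<And>m. m \<in> M \<Longrightarrow> b \<le> C * norm (x - m) + h m" for b x
    unfolding q_def using M0 that by (intro cINF_greatest) auto
  have "q (x + y) \<le> (C * norm (x - m) + h m) + (C * norm (y - n) + h n)"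
    if "m \<in> M" "n \<in> M" for x y m n
  proof -
    have "q (x + y) \<le> C * norm ((x - m) + (y - n)) + h (m + n)"
      using q_le[of "m + n" "x + y"] Madd that by (simp add: algebra_simps)
    also have "\<dots> \<le> C * (norm (x - m) + norm (y - n)) + h (m + n)"
      using C norm_triangle_ineq by (intro add_mono mult_left_mono) auto
    finally show ?thesis using add that by (simp add: algebra_simps)
  qed
  then have "q (x + y) - (C * norm (y - n) + h n) \<le> q x" if "n \<in> M" for x y n
    using that by (intro q_ge) (simp only: diff_le_eq)
  then have "q (x + y) - q x \<le> q y" for x y
    by (intro q_ge) (simp add: algebra_simps)
  then have q_add: "q (x + y) \<le> q x + q y" for x y by (simp add: algebra_simps)
  have "q (c *\<^sub>R x) \<le> c * q x" if c: "c \<ge> 0" for c x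
  proof (cases "c = 0")
    case True
    then show ?thesis using q_le[OF M0, of 0] h0 by simp
  next
    case False
    have "q (c *\<^sub>R x) \<le> c * (C * norm (x - m) + h m)" if "m \<in> M" for m
    proof -
      have "q (c *\<^sub>R x) \<le> C * norm (c *\<^sub>R x - c *\<^sub>R m) + h (c *\<^sub>R m)"
        using that Mscale by (intro q_le)
      also have "norm (c *\<^sub>R x - c *\<^sub>R m) = c * norm (x - m)"
        using c by (simp flip: scaleR_diff_right)
      finally show ?thesis using scale that by (simp add: algebra_simps)
    qed
    then have "q (c *\<^sub>R x) / c \<le> q x"
      using False c by (intro q_ge) (simp add: field_simps)
    then show ?thesis using False c by (simp add: field_simps)
  qed
  with q_add have "sublinear q" by (simp add: sublinear_def)
  then obtain m where m: "sublinear m" "m \<le> q" "\<And>r. sublinear r \<Longrightarrow> r \<le> m \<Longrightarrow> r = m"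
    using exists_minimal_sublinear by blast
  then have lin: "linear m" by (simp add: minimal_sublinear_linear)
  have m_le: "m x \<le> C * norm x" for x
    using le_funD[OF m(2), of x] q_le[OF M0, of x] h0 by simp
  have abs_le: "\<bar>m x\<bar> \<le> C * norm x" for x
    using m_le[of x] m_le[of "- x"] linear_neg[OF lin] by (simp add: abs_le_iff)
  have m_le_h: "m x \<le> h x" if "x \<in> M" for x
    using le_funD[OF m(2), of x] q_le[OF that, of x] by simp
  have "m x = h x" if x: "x \<in> M" for x
  proof -
    have "h (- x) = - h x" "- x \<in> M" using scale[OF x, of "-1"] Mscale[OF x, of "-1"] by auto
    then show ?thesis using m_le_h[OF x] m_le_h[of "- x"] linear_neg[OF lin] by simp
  qed
  moreover have "bounded_linear m"
    using lin abs_le by (intro bounded_linear_intro[where K = C])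
      (auto simp: linear_add linear_cmul mult.commute)
  ultimately show ?thesis
    using abs_le by (intro exI[of _ "Blinfun m"]) (auto simp: bounded_linear_Blinfun_apply)
qed

text \<open>On the line through \<open>x\<close> the functional sending \<open>k *\<^sub>R x\<close>
  to \<open>k * norm x\<close> has bound 1. The algebraic extension \<open>h\<close> may be
  unbounded on the whole space; only its values on that line enter Hahn-Banach.\<close>

corollary exists_norming_functional:
  fixes x :: "'v::real_normed_vector"
  obtains g :: "'v \<Rightarrow>\<^sub>L real" where "norm g \<le> 1" "blinfun_apply g x = norm x"
proof (cases "x = 0")
  case True
  then show ?thesis using that[of 0] by simp
next
  case False
  obtain h where h: "linear h" "h x = norm x"
    using linear_independent_extend[of "{x}" "\<lambda>_. norm x"] False by (auto simp: dependent_single)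
  have "\<exists>g :: 'v \<Rightarrow>\<^sub>L real. (\<forall>y\<in>span {x}. blinfun_apply g y = h y) \<and> (\<forall>y. \<bar>blinfun_apply g y\<bar> \<le> 1 * norm y)"
  proof (rule hahn_banach[of "span {x}" h 1])
    show "\<bar>h y\<bar> \<le> 1 * norm y" if "y \<in> span {x}" for y
      using that h by (auto simp: span_singleton linear_cmul abs_mult)
  qed (use h(1) in \<open>simp_all add: linear_add linear_cmul\<close>)
  then obtain g :: "'v \<Rightarrow>\<^sub>L real" where
    g: "\<And>y. y \<in> span {x} \<Longrightarrow> blinfun_apply g y = h y" "\<And>y. \<bar>blinfun_apply g y\<bar> \<le> 1 * norm y"
    by blast
  have "norm g \<le> 1" using g(2) by (intro norm_blinfun_bound) auto
  moreover have "blinfun_apply g x = norm x" using g(1) h(2) by (simp add: span_base)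
  ultimately show ?thesis by (rule that)
qed

text \<open>The coefficient of \<open>x\<close> is a functional on the span of \<open>S\<close> and
  \<open>x\<close>. If \<open>d\<close> bounds the distance from \<open>x\<close> to the span of
  \<open>S\<close> from below, then a vector with coefficient \<open>k\<close> has norm at least
  \<open>\<bar>k\<bar> * d\<close>, so this functional has bound \<open>inverse d\<close> and
  extends. The basis \<open>B\<close> of the span of \<open>S\<close> serves to define the
  coefficient.\<close>

corollary exists_functional_vanishing_on_span:
  fixes x :: "'v::real_normed_vector"
  assumes x: "x \<notin> closure (span S)"
  obtains g :: "'v \<Rightarrow>\<^sub>L real" where "\<And>s. s \<in> S \<Longrightarrow> blinfun_apply g s = 0" "blinfun_apply g x = 1"
proof -
  obtain B where B: "B \<subseteq> S" "independent B" "S \<subseteq> span B"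
    using maximal_independent_subset[of S] by blast
  then have span: "span B = span S" by (simp add: span_eq span_mono subset_trans[OF _ span_superset])
  have xB: "x \<notin> span B" using x closure_subset span by blast
  then have "independent (insert x B)" using B(2) by (simp add: independent_insert)
  then obtain h where h: "linear h" "\<forall>b\<in>insert x B. h b = (if b = x then 1 else 0 :: real)"
    using linear_independent_extend[of "insert x B" "\<lambda>b. if b = x then 1 else 0 :: real"] by blast
  have hB: "h b = 0" if "b \<in> span B" for b
    using h(1) _ that
  proof (rule linear_eq_0_on_span)
    show "h c = 0" if "c \<in> B" for c
      using bspec[OF h(2), of c] that xB span_base[of c B] by auto
  qed
  have hx: "h x = 1" using h(2) by simp
  obtain d where d: "d > 0" "\<And>y. y \<in> span S \<Longrightarrow> d \<le> dist y x"
    using x by (auto simp: closure_approachable not_less)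
  have "\<exists>g :: 'v \<Rightarrow>\<^sub>L real. (\<forall>y\<in>span (insert x B). blinfun_apply g y = h y) \<and>
      (\<forall>y. \<bar>blinfun_apply g y\<bar> \<le> inverse d * norm y)"
  proof (rule hahn_banach[of "span (insert x B)" h "inverse d"])
    show "\<bar>h y\<bar> \<le> inverse d * norm y" if "y \<in> span (insert x B)" for y
    proof -
      obtain k where k: "y - k *\<^sub>R x \<in> span B" using \<open>y \<in> _\<close> by (auto simp: span_breakdown_eq)
      have "h (y - k *\<^sub>R x) = h y - k" using h(1) hx by (simp add: linear_diff linear_cmul)
      then have hy: "h y = k" using hB[OF k] by simp
      show ?thesis
      proof (cases "k = 0")
        case True
        then show ?thesis using hy d by simp
      next
        case False
        have "x - inverse k *\<^sub>R y = (- inverse k) *\<^sub>R (y - k *\<^sub>R x)"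
          using False by (simp add: algebra_simps)
        then have "x - inverse k *\<^sub>R y \<in> span S" using span_scale[OF k, of "- inverse k"] span by simp
        then have "d \<le> dist (x - inverse k *\<^sub>R y) x" by (rule d(2))
        then have "d \<le> inverse \<bar>k\<bar> * norm y" by (simp add: dist_norm)
        then show ?thesis using hy False d(1) by (simp add: field_simps)
      qed
    qed
  qed (use h(1) d in \<open>simp_all add: linear_add linear_cmul\<close>)
  then obtain g :: "'v \<Rightarrow>\<^sub>L real" where
    g: "\<And>y. y \<in> span (insert x B) \<Longrightarrow> blinfun_apply g y = h y"
    by blast
  show ?thesis
  proof
    show "blinfun_apply g s = 0" if "s \<in> S" for s
    proof -
      have "s \<in> span B" using B(3) that by blast
      then have "s \<in> span (insert x B)" using span_mono[of B "insert x B"] by blast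
      then show ?thesis using g hB[OF \<open>s \<in> span B\<close>] by simp
    qed
    show "blinfun_apply g x = 1" using g hx by (simp add: span_base)
  qed
qed

section \<open>Evaluations at points among the functionals on the dual\<close>

section \<open>Functionals on the dual space\<close>

text \<open>A functional that vanishes on the common kernel of finitely many evaluations is a linear
  combination of them, hence itself an evaluation. In the induction, either every functional
  annihilating \<open>S\<close> also annihilates \<open>a\<close>, or a multiple of the evaluation
  at \<open>a\<close> is split off.\<close>

lemma evaluation_of_kernel_inclusion:
  fixes g :: "('v::real_normed_vector \<Rightarrow>\<^sub>L real) \<Rightarrow> real"
  assumes "finite S" "linear g"
    and "\<And>f. (\<And>s. s \<in> S \<Longrightarrow> blinfun_apply f s = 0) \<Longrightarrow> g f = 0"
  shows "\<exists>y. \<forall>f. g f = blinfun_apply f y"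
  using assms
proof (induction S arbitrary: g rule: finite_induct)
  case empty
  then show ?case by (intro exI[of _ 0]) simp
next
  case (insert a S)
  show ?case
  proof (cases "\<exists>v :: 'v \<Rightarrow>\<^sub>L real. (\<forall>s\<in>S. blinfun_apply v s = 0) \<and> blinfun_apply v a \<noteq> 0")
    case False
    show ?thesis
    proof (rule insert.IH[OF insert.prems(1)])
      show "g f = 0" if "\<And>s. s \<in> S \<Longrightarrow> blinfun_apply f s = 0" for f
      proof -
        have "\<forall>s\<in>S. blinfun_apply f s = 0" using that by simp
        with False have "\<forall>s\<in>insert a S. blinfun_apply f s = 0" by blast
        then show ?thesis by (intro insert.prems(2)) (rule bspec)
      qed
    qed
  next
    case True
    then obtain v :: "'v \<Rightarrow>\<^sub>L real" where v: "\<And>s. s \<in> S \<Longrightarrow> blinfun_apply v s = 0" "blinfun_apply v a \<noteq> 0" by blast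
    \<comment> \<open>This \<open>c\<close> makes \<open>g\<close> minus \<open>c\<close> times the
      evaluation at \<open>a\<close> vanish at \<open>v\<close>. Every \<open>f\<close> annihilating
      \<open>S\<close> is a multiple of \<open>v\<close> plus a functional annihilating
      \<open>insert a S\<close>, where \<open>g\<close> is zero.\<close>
    define c where "c = g v / blinfun_apply v a"
    have "\<exists>y. \<forall>f. g f - c * blinfun_apply f a = blinfun_apply f y"
    proof (rule insert.IH)
      show "linear (\<lambda>f. g f - c * blinfun_apply f a)"
        using insert.prems(1)
        by (intro linearI) (simp_all add: linear_add linear_cmul blinfun.add_left blinfun.scaleR_left algebra_simps)
      fix f :: "'v \<Rightarrow>\<^sub>L real" assume f: "\<And>s. s \<in> S \<Longrightarrow> blinfun_apply f s = 0"
      have "g (f - (blinfun_apply f a / blinfun_apply v a) *\<^sub>R v) = 0"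
        using f v by (intro insert.prems(2)) (auto simp: blinfun.diff_left blinfun.scaleR_left)
      then show "g f - c * blinfun_apply f a = 0"
        using insert.prems(1) by (simp add: linear_diff linear_cmul c_def field_simps)
    qed
    then obtain y where y: "\<And>f. g f - c * blinfun_apply f a = blinfun_apply f y" by blast
    have "g f = blinfun_apply f (y + c *\<^sub>R a)" for f
      using y[of f] by (simp add: blinfun.add_right blinfun.scaleR_right)
    then show ?thesis by blast
  qed
qed

text \<open>Restricted to the annihilator of \<open>S\<close>, the norm of \<open>z\<close> is its distance to the span of \<open>S\<close>:
  a norm-preserving extension of the restriction differs from \<open>z\<close> by a point of that span.\<close>

lemma helly_annihilator:
  fixes z :: "('v::real_normed_vector \<Rightarrow>\<^sub>L real) \<Rightarrow> real"
  assumes z: "linear z" and d: "0 \<le> d" and S: "finite S"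
    and far: "\<And>y. \<exists>f. d * norm f < \<bar>z f - blinfun_apply f y\<bar>"
  obtains f where "norm f \<le> 1" "d < z f" "\<And>s. s \<in> S \<Longrightarrow> blinfun_apply f s = 0"
proof -
  define N where "N = {f :: 'v \<Rightarrow>\<^sub>L real. \<forall>s\<in>S. blinfun_apply f s = 0}"
  have N: "subspace N"
    by (auto simp: N_def subspace_def blinfun.add_left blinfun.scaleR_left)
  have "\<exists>f\<in>N. d * norm f < \<bar>z f\<bar>"
  proof (rule ccontr)
    assume "\<not> ?thesis"
    then have bound: "\<bar>z f\<bar> \<le> d * norm f" if "f \<in> N" for f
      using that by (auto simp: not_less)
    have "\<exists>\<psi>. (\<forall>f\<in>N. blinfun_apply \<psi> f = z f) \<and> (\<forall>f. \<bar>blinfun_apply \<psi> f\<bar> \<le> d * norm f)"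
      using N d bound by (intro hahn_banach linear_add[OF z]) (simp_all add: linear_cmul[OF z])
    then obtain \<psi> where \<psi>: "\<And>f. f \<in> N \<Longrightarrow> blinfun_apply \<psi> f = z f" "\<And>f. \<bar>blinfun_apply \<psi> f\<bar> \<le> d * norm f"
      by blast
    have "\<exists>y. \<forall>f. z f - blinfun_apply \<psi> f = blinfun_apply f y"
    proof (rule evaluation_of_kernel_inclusion[OF S])
      show "linear (\<lambda>f. z f - blinfun_apply \<psi> f)"
        using z by (intro linearI)
          (simp_all add: linear_add linear_cmul blinfun.add_right blinfun.scaleR_right algebra_simps)
    qed (simp add: \<psi>(1) N_def)
    then obtain y where y: "\<And>f. z f - blinfun_apply \<psi> f = blinfun_apply f y" by blast
    obtain f where "d * norm f < \<bar>z f - blinfun_apply f y\<bar>" using far by blast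
    then show False using y[of f] \<psi>(2)[of f] by simp
  qed
  then obtain f where f: "f \<in> N" "d * norm f < \<bar>z f\<bar>" by blast
  have "z f \<noteq> 0" using f(2) mult_nonneg_nonneg[OF d norm_ge_zero[of f]] by linarith
  then have "f \<noteq> 0" using z linear_0 by blast
  \<comment> \<open>Dividing by the norm turns the strict inequality for \<open>f\<close> into
    \<open>d < z e\<close>; the sign makes the value at \<open>e\<close> positive.\<close>
  define e where "e = (sgn (z f) / norm f) *\<^sub>R f"
  show ?thesis
  proof
    show "norm e \<le> 1" using \<open>f \<noteq> 0\<close> \<open>z f \<noteq> 0\<close> by (simp add: e_def abs_sgn_eq)
    have "z e = \<bar>z f\<bar> / norm f" using z by (simp add: e_def linear_cmul linordered_idom_class.abs_sgn)
    then show "d < z e" using f(2) \<open>f \<noteq> 0\<close> by (simp add: pos_less_divide_eq)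
    show "blinfun_apply e s = 0" if "s \<in> S" for s
      using f(1) that by (simp add: N_def e_def blinfun.scaleR_left)
  qed
qed

text \<open>The evaluations are closed under uniform approximation on the dual ball: if points
  \<open>y n\<close> approximate \<open>z\<close> ever better, norming functionals for
  \<open>y m - y n\<close> show that \<open>y\<close> is Cauchy, and by completeness its limit
  represents \<open>z\<close>.\<close>

lemma far_from_evaluations:
  fixes z :: "('v::banach \<Rightarrow>\<^sub>L real) \<Rightarrow> real"
  assumes "\<nexists>y. \<forall>f. z f = blinfun_apply f y"
  obtains d where "0 < d" "\<And>y. \<exists>f. d * norm f < \<bar>z f - blinfun_apply f y\<bar>"
proof -
  have "\<exists>d>0. \<forall>y. \<exists>f. d * norm f < \<bar>z f - blinfun_apply f y\<bar>"
  proof (rule ccontr)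
    assume neg: "\<not> ?thesis"
    have near: "\<exists>y. \<forall>f. \<bar>z f - blinfun_apply f y\<bar> \<le> d * norm f" if "0 < d" for d
      using neg that by (meson not_less)
    have "\<forall>n. \<exists>y. \<forall>f. \<bar>z f - blinfun_apply f y\<bar> \<le> inverse (real (Suc n)) * norm f"
      by (intro allI near) simp
    from choice[OF this] obtain y
      where y: "\<And>n f. \<bar>z f - blinfun_apply f (y n)\<bar> \<le> inverse (real (Suc n)) * norm f"
      by blast
    have close: "norm (y m - y n) \<le> inverse (real (Suc m)) + inverse (real (Suc n))" for m n
    proof -
      obtain f :: "'v \<Rightarrow>\<^sub>L real" where f: "norm f \<le> 1" "blinfun_apply f (y m - y n) = norm (y m - y n)"
        using exists_norming_functional by blast
      have "norm (y m - y n) \<le> inverse (real (Suc m)) * norm f + inverse (real (Suc n)) * norm f"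
        using y[of f m] y[of f n] f(2) by (simp add: blinfun.diff_right)
      also have "\<dots> \<le> inverse (real (Suc m)) * 1 + inverse (real (Suc n)) * 1"
        using f(1) by (intro add_mono mult_left_mono) auto
      finally show ?thesis by simp
    qed
    have "Cauchy y"
    proof (rule CauchyI)
      fix e :: real assume "e > 0"
      then obtain N where N: "inverse (real (Suc N)) < e / 2"
        using reals_Archimedean[of "e / 2"] by auto
      have "norm (y m - y n) < e" if "N \<le> m" "N \<le> n" for m n
      proof -
        have "inverse (real (Suc m)) \<le> inverse (real (Suc N))" "inverse (real (Suc n)) \<le> inverse (real (Suc N))"
          using that by (auto intro!: le_imp_inverse_le)
        then show ?thesis using close[of m n] N by linarith
      qed
      then show "\<exists>M. \<forall>m\<ge>M. \<forall>n\<ge>M. norm (y m - y n) < e" by blast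
    qed
    then obtain l where l: "y \<longlonglongrightarrow> l" using Cauchy_convergent convergent_def by blast
    have "z f = blinfun_apply f l" for f
    proof -
      have "(\<lambda>n. inverse (real (Suc n)) * norm f) \<longlonglongrightarrow> 0 * norm f"
        by (intro tendsto_intros LIMSEQ_inverse_real_of_nat)
      then have lim0: "(\<lambda>n. inverse (real (Suc n)) * norm f) \<longlonglongrightarrow> 0" by simp
      have "(\<lambda>n. z f - blinfun_apply f (y n)) \<longlonglongrightarrow> 0"
        by (rule Lim_null_comparison[OF _ lim0]) (simp only: real_norm_def y eventually_True)
      moreover have "(\<lambda>n. z f - blinfun_apply f (y n)) \<longlonglongrightarrow> z f - blinfun_apply f l"
        using l by (intro tendsto_intros)
      ultimately show ?thesis using LIMSEQ_unique by fastforce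
    qed
    with assms show False by blast
  qed
  with that show ?thesis by blast
qed

section \<open>Weakly open and closed sets, and weak cluster points of sequences\<close>

section \<open>The weak topology\<close>

lemma topspace_weak_topology [simp]: "topspace weak_topology = UNIV"
proof -
  have "UNIV \<in> {blinfun_apply f -` U |(f :: 'b::real_normed_vector \<Rightarrow>\<^sub>L real) U. open U}"
    by (rule CollectI, rule exI[of _ 0], rule exI[of _ UNIV]) simp
  then show ?thesis unfolding weak_topology_def topology_generated_by_topspace by blast
qed

lemma openin_weak_topology_vimage:
  fixes f :: "'b::real_normed_vector \<Rightarrow>\<^sub>L real"
  assumes "open U"
  shows "openin weak_topology (blinfun_apply f -` U)"
  unfolding weak_topology_def using assms by (intro topology_generated_by_Basis) blast

lemma closedin_weak_topology_vimage:
  fixes f :: "'b::real_normed_vector \<Rightarrow>\<^sub>L real"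
  assumes "closed U"
  shows "closedin weak_topology (blinfun_apply f -` U)"
  using openin_weak_topology_vimage[of "- U" f] assms
  by (simp add: closedin_def open_Compl vimage_Compl flip: Compl_eq_Diff_UNIV)

lemma continuous_map_weak_topology:
  fixes f :: "'b::real_normed_vector \<Rightarrow>\<^sub>L real"
  shows "continuous_map weak_topology euclideanreal (blinfun_apply f)"
  unfolding continuous_map_def using openin_weak_topology_vimage by (auto simp: vimage_def)

text \<open>By the finite intersection property some \<open>x\<close> lies in the weak closure of
  every tail. Half-spaces are weakly closed, so lower bounds valid on a tail pass to
  \<open>x\<close>; Eberlein's argument uses the cluster point in this form.\<close>

lemma weak_cluster_point:
  fixes s :: "nat \<Rightarrow> 'b::real_normed_vector"
  assumes C: "compactin weak_topology C" and s: "range s \<subseteq> C"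
  obtains x where "\<And>f n c. (\<And>m. n \<le> m \<Longrightarrow> c \<le> blinfun_apply f (s m)) \<Longrightarrow> (c::real) \<le> blinfun_apply f x"
proof -
  define K where "K n = weak_topology closure_of (s ` {n..})" for n
  have fip: "C \<inter> \<Inter>F \<noteq> {}" if F: "finite F" "F \<subseteq> range K" for F
  proof -
    obtain I where I: "finite I" "F = K ` I" using finite_subset_image[OF F] by blast
    then obtain N where N: "\<forall>i\<in>I. i \<le> N" by (meson finite_nat_set_iff_bounded_le)
    have "s N \<in> K i" if "i \<in> I" for i
      unfolding K_def using N that closure_of_subset[of "s ` {i..}" weak_topology] by auto
    then have "s N \<in> C \<inter> \<Inter>F" using I s by auto
    then show ?thesis by blast
  qed
  have "C \<inter> \<Inter>(range K) \<noteq> {}"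
    using C fip unfolding compactin_fip by (auto simp: K_def)
  then obtain x where x: "\<And>n. x \<in> K n" by blast
  show ?thesis
  proof
    fix f :: "'b \<Rightarrow>\<^sub>L real" and n c assume "\<And>m. n \<le> m \<Longrightarrow> c \<le> blinfun_apply f (s m)"
    then have "s ` {n..} \<subseteq> blinfun_apply f -` {c..}" by auto
    then have "K n \<subseteq> blinfun_apply f -` {c..}"
      unfolding K_def by (rule closure_of_minimal) (simp add: closedin_weak_topology_vimage)
    then show "c \<le> blinfun_apply f x" using x[of n] by auto
  qed
qed

section \<open>Eberlein's theorem through the weak-star closure in the bidual\<close>

section \<open>Eberlein's theorem\<close>

text \<open>The assumption \<open>approx\<close> places \<open>z\<close> in the weak-star closure of
  the evaluations at points of \<open>A\<close>. If \<open>z\<close> were not an evaluation, the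
  alternating choice of functionals and points would give a sequence in \<open>A\<close>
  contradicting \<open>seq\<close>.\<close>

lemma eberlein_functional:
  fixes z :: "('v::banach \<Rightarrow>\<^sub>L real) \<Rightarrow> real"
  assumes lin: "linear z"
    and approx: "\<And>F e. finite F \<Longrightarrow> 0 < e \<Longrightarrow> \<exists>a\<in>A. \<forall>f\<in>F. \<bar>z f - blinfun_apply f a\<bar> < e"
    and seq: "\<And>s :: nat \<Rightarrow> 'v. range s \<subseteq> A \<Longrightarrow> \<exists>C. compactin weak_topology C \<and> range s \<subseteq> C"
  shows "\<exists>y. \<forall>f. z f = blinfun_apply f y"
proof (rule ccontr)
  assume "\<not> ?thesis"
  then obtain d where d: "0 < d" "\<And>y. \<exists>f. d * norm f < \<bar>z f - blinfun_apply f y\<bar>"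
    using far_from_evaluations by blast
  \<comment> \<open>The pair \<open>r\<close> is the next functional and the next point, and
    \<open>h\<close> holds the earlier pairs. \<open>P h n\<close> reads \<open>h\<close> only below
    \<open>n\<close>, as a recursive choice demands.\<close>
  define P where "P h n r \<longleftrightarrow> norm (fst r) \<le> 1 \<and> d < z (fst r) \<and> snd r \<in> A
      \<and> d < blinfun_apply (fst r) (snd r)
      \<and> (\<forall>i<n. blinfun_apply (fst r) (snd (h i)) = 0 \<and> d < blinfun_apply (fst (h i)) (snd r))"
    for h :: "nat \<Rightarrow> ('v \<Rightarrow>\<^sub>L real) \<times> 'v" and n r
  have "\<exists>h. \<forall>n. P h n (h n)"
  proof (rule dependent_wellorder_choice)
    show "P h n r = P g n r" if "\<And>y. y < n \<Longrightarrow> h y = g y" for r h g and n :: nat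
      using that by (auto simp: P_def)
    fix n :: nat and h assume IH: "\<And>y. y < n \<Longrightarrow> P h y (h y)"
    have "finite ((\<lambda>i. snd (h i)) ` {..<n})" by simp
    then obtain f where f: "norm f \<le> 1" "d < z f" "\<And>s. s \<in> (\<lambda>i. snd (h i)) ` {..<n} \<Longrightarrow> blinfun_apply f s = 0"
      using helly_annihilator[OF lin less_imp_le[OF d(1)]] d(2) by blast
    define F where "F = insert f ((\<lambda>i. fst (h i)) ` {..<n})"
    have F: "finite F" "F \<noteq> {}" by (auto simp: F_def)
    have zF: "d < z g" if "g \<in> F" for g
      using that f(2) IH by (auto simp: F_def P_def)
    \<comment> \<open>The least excess of \<open>z\<close> over \<open>d\<close> on the functionals
      chosen so far: a point approximating \<open>z\<close> on \<open>F\<close> within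
      \<open>e\<close> has all these values above \<open>d\<close>.\<close>
    define e where "e = Min (z ` F) - d"
    have "0 < e" using F zF by (simp add: e_def)
    then obtain a where a: "a \<in> A" "\<forall>g\<in>F. \<bar>z g - blinfun_apply g a\<bar> < e" using approx[OF F(1)] by blast
    have "d < blinfun_apply g a" if "g \<in> F" for g
    proof -
      have "Min (z ` F) \<le> z g" using F that by simp
      moreover have "\<bar>z g - blinfun_apply g a\<bar> < e" using a(2) that by blast
      ultimately show ?thesis by (simp add: e_def)
    qed
    then have "P h n (f, a)" using f a(1) by (simp add: P_def F_def)
    then show "\<exists>r. P h n r" ..
  qed
  then obtain h where h: "\<And>n. P h n (h n)" by blast
  define f where "f n = fst (h n)" for n
  define s where "s n = snd (h n)" for n
  have f1: "norm (f n) \<le> 1" and sA: "s n \<in> A" and fs0: "i < n \<Longrightarrow> blinfun_apply (f n) (s i) = 0" for n i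
    using h[of n] by (auto simp: P_def f_def s_def)
  have fsd: "d \<le> blinfun_apply (f i) (s n)" if "i \<le> n" for i n
  proof -
    have "i = n \<or> i < n" using that by linarith
    then show ?thesis using h[of n] by (auto simp: P_def f_def s_def intro: less_imp_le)
  qed
  obtain C where C: "compactin weak_topology C" "range s \<subseteq> C" using seq[of s] sA by blast
  obtain x where x: "\<And>(f :: 'v \<Rightarrow>\<^sub>L real) n c. (\<And>m. n \<le> m \<Longrightarrow> c \<le> blinfun_apply f (s m)) \<Longrightarrow> c \<le> blinfun_apply f x"
    using weak_cluster_point[OF C] by blast
  have fx: "d \<le> blinfun_apply (f n) x" for n using fsd by (rule x)
  have "x \<in> closure (span (range s))"
  proof (rule ccontr)
    assume "x \<notin> closure (span (range s))"
    then obtain g :: "'v \<Rightarrow>\<^sub>L real" where g: "\<And>s'. s' \<in> range s \<Longrightarrow> blinfun_apply g s' = 0" "blinfun_apply g x = 1"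
      using exists_functional_vanishing_on_span by blast
    \<comment> \<open>The cluster property for \<open>- g\<close> gives \<open>g x \<le> 0\<close>,
      against \<open>g x = 1\<close>.\<close>
    have "0 \<le> blinfun_apply (- g) x" by (rule x[of 0]) (simp add: g(1) blinfun.minus_left)
    then show False using g(2) by (simp add: blinfun.minus_left)
  qed
  then obtain y where y: "y \<in> span (range s)" "norm (y - x) < d"
    using d(1) by (auto simp: closure_approachable dist_norm)
  \<comment> \<open>Only finitely many \<open>s i\<close> occur in a given element of the span, and
    \<open>f n\<close> kills \<open>s i\<close> as soon as \<open>i < n\<close>.\<close>
  have "\<exists>N. \<forall>n\<ge>N. blinfun_apply (f n) y = 0"
    using y(1)
  proof (induction rule: span_induct_alt)
    case base
    then show ?case by simp
  next
    case (step c b w)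
    then obtain N where N: "\<forall>n\<ge>N. blinfun_apply (f n) w = 0" by blast
    obtain i where i: "b = s i" using step by blast
    have "\<forall>n\<ge>max N (Suc i). blinfun_apply (f n) (c *\<^sub>R b + w) = 0"
      using N fs0 i by (simp add: blinfun.add_right blinfun.scaleR_right)
    then show ?case by blast
  qed
  then obtain N where N: "blinfun_apply (f N) y = 0" by blast
  have "d \<le> blinfun_apply (f N) (x - y)" using fx[of N] N by (simp add: blinfun.diff_right)
  also have "\<dots> \<le> norm (f N) * norm (x - y)" using norm_blinfun[of "f N" "x - y"] by simp
  also have "\<dots> \<le> 1 * norm (x - y)" using f1 by (intro mult_right_mono) auto
  finally show False using y(2) by (simp add: norm_minus_commute)
qed

text \<open>The map \<open>J\<close> embeds the space with its weak topology into the product of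
  real lines indexed by the dual. There the closure \<open>Z\<close> of the image of
  \<open>A\<close> is compact, and \<open>eberlein_functional\<close> keeps it inside
  \<open>range J\<close>, so compactness can be pulled back.\<close>

theorem eberlein:
  fixes A :: "'v::banach set"
  assumes A: "bounded A"
    and seq: "\<And>s :: nat \<Rightarrow> 'v. range s \<subseteq> A \<Longrightarrow> \<exists>C. compactin weak_topology C \<and> range s \<subseteq> C"
  shows "relatively_weakly_compact A"
proof -
  define P where "P = (powertop_real UNIV :: (('v \<Rightarrow>\<^sub>L real) \<Rightarrow> real) topology)"
  define J where "J x = (\<lambda>f :: 'v \<Rightarrow>\<^sub>L real. blinfun_apply f x)" for x
  define Z where "Z = P closure_of (J ` A)"
  have topP [simp]: "topspace P = UNIV" by (simp add: P_def)
  have proj: "continuous_map P euclideanreal (\<lambda>z. z f)" for f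
    unfolding P_def by (rule continuous_map_product_projection) simp
  have contJ: "continuous_map weak_topology P J"
    unfolding P_def J_def by (simp add: continuous_map_componentwise_UNIV continuous_map_weak_topology)
  have injJ: "inj J"
  proof (rule injI)
    fix x y assume xy: "J x = J y"
    obtain g :: "'v \<Rightarrow>\<^sub>L real" where g: "blinfun_apply g (x - y) = norm (x - y)"
      using exists_norming_functional by blast
    have "blinfun_apply g x = blinfun_apply g y" using fun_cong[OF xy, of g] by (simp add: J_def)
    then show "x = y" using g by (simp add: blinfun.diff_right)
  qed
  obtain B where B: "\<And>a. a \<in> A \<Longrightarrow> norm a \<le> B" using A unfolding bounded_iff by blast
  have Zcl: "closedin P Z" by (simp add: Z_def)
  have AZ: "J ` A \<subseteq> Z" unfolding Z_def by (rule closure_of_subset) simp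
  have Z_minimal: "Z \<subseteq> T" if "closedin P T" "\<And>a. a \<in> A \<Longrightarrow> J a \<in> T" for T
    unfolding Z_def using that by (intro closure_of_minimal) auto
  have compZ: "compactin P Z"
  proof -
    \<comment> \<open>A box whose sides come from the bound \<open>B\<close> on \<open>A\<close>; it
      is compact by Tychonoff's theorem.\<close>
    define K where "K = (\<Pi>\<^sub>E f\<in>UNIV. {- (norm (f :: 'v \<Rightarrow>\<^sub>L real) * B) .. norm f * B})"
    have K: "compactin P K" unfolding P_def K_def by (simp add: compactin_PiE)
    have "closedin P K" unfolding P_def K_def by (simp add: closedin_product_topology)
    then have "Z \<subseteq> K"
    proof (rule Z_minimal)
      fix a assume a: "a \<in> A"
      have "\<bar>blinfun_apply f a\<bar> \<le> norm f * B" for f :: "'v \<Rightarrow>\<^sub>L real"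
        using norm_blinfun[of f a] mult_left_mono[OF B[OF a] norm_ge_zero[of f]] by simp
      then show "J a \<in> K" by (auto simp: K_def J_def abs_le_iff minus_le_iff)
    qed
    then show ?thesis using closed_compactin[OF K] Zcl by blast
  qed
  have Z_range: "z \<in> range J" if z: "z \<in> Z" for z
  proof -
    \<comment> \<open>Each additivity or homogeneity equation defines a closed subset of the product
      that contains \<open>J\<close> followed by any point of \<open>A\<close>, hence it holds on
      all of \<open>Z\<close>.\<close>
    have "linear z"
    proof (rule linearI)
      fix f g
      have "closedin P {z \<in> topspace P. z (f + g) - (z f + z g) \<in> {0}}"
        by (intro closedin_continuous_map_preimage[where Y = euclideanreal] continuous_map_diff continuous_map_add proj) simp
      from Z_minimal[OF this] z show "z (f + g) = z f + z g"
        by (auto simp: J_def blinfun.add_left)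
    next
      fix r f
      have "closedin P {z \<in> topspace P. z (r *\<^sub>R f) - r * z f \<in> {0}}"
        by (intro closedin_continuous_map_preimage[where Y = euclideanreal] continuous_map_diff
            continuous_map_real_mult_left proj) simp
      from Z_minimal[OF this] z show "z (r *\<^sub>R f) = r *\<^sub>R z f"
        by (auto simp: J_def blinfun.scaleR_left)
    qed
    moreover have "\<exists>a\<in>A. \<forall>f\<in>F. \<bar>z f - blinfun_apply f a\<bar> < e" if F: "finite F" and e: "0 < e" for F e
    proof -
      have op: "openin P {w \<in> topspace P. w f \<in> ball (z f) e}" for f
        by (intro openin_continuous_map_preimage[where Y = euclideanreal] proj) simp
      define T where "T = topspace P \<inter> (\<Inter>f\<in>F. {w. w f \<in> ball (z f) e})"
      have "openin P T"
        unfolding T_def using F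
      proof (induction F rule: finite_induct)
        case empty
        then show ?case using openin_topspace[of P] by simp
      next
        case (insert f F)
        then show ?case using openin_Int[OF op[of f] insert.IH] by (simp add: Collect_conj_eq Int_ac)
      qed
      moreover have "z \<in> T" using e by (simp add: T_def)
      moreover have "\<forall>T. z \<in> T \<and> openin P T \<longrightarrow> (\<exists>w. w \<in> J ` A \<and> w \<in> T)"
        using z unfolding Z_def in_closure_of by (rule conjunct2)
      ultimately obtain w where "w \<in> J ` A" "w \<in> T" by blast
      then show ?thesis by (auto simp: J_def T_def dist_real_def)
    qed
    ultimately obtain y where "\<And>f. z f = blinfun_apply f y"
      using eberlein_functional[of z A] seq by blast
    then have "z = J y" by (auto simp: J_def)
    then show ?thesis by blast
  qed
  \<comment> \<open>A subbasic weakly open set is the preimage under \<open>J\<close> of a condition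
    on one coordinate, so \<open>inv J\<close> is continuous on \<open>range J\<close>.\<close>
  have "continuous_map (subtopology P (range J)) weak_topology (inv J)"
    unfolding weak_topology_def
  proof (rule continuous_on_generated_topo)
    fix W assume "W \<in> {blinfun_apply f -` U |(f :: 'v \<Rightarrow>\<^sub>L real) U. open U}"
    then obtain f :: "'v \<Rightarrow>\<^sub>L real" and U where U: "open U" "W = blinfun_apply f -` U" by blast
    have "inv J -` W \<inter> topspace (subtopology P (range J)) = {z \<in> topspace P. z f \<in> U} \<inter> range J"
      using injJ by (auto simp: U(2) J_def[of _, symmetric] inv_f_f) (simp_all add: J_def)
    moreover have "openin P {z \<in> topspace P. z f \<in> U}"
      using U(1) by (intro openin_continuous_map_preimage[where Y = euclideanreal] proj) simp
    ultimately show "openin (subtopology P (range J)) (inv J -` W \<inter> topspace (subtopology P (range J)))"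
      by (auto simp: openin_subtopology)
  next
    have "topspace (weak_topology :: 'v topology) = UNIV" by simp
    then show "inv J ` topspace (subtopology P (range J)) \<subseteq> \<Union>{blinfun_apply f -` U |(f :: 'v \<Rightarrow>\<^sub>L real) U. open U}"
      unfolding weak_topology_def topology_generated_by_topspace by (simp only: subset_UNIV)
  qed
  moreover have "compactin (subtopology P (range J)) Z"
    using compZ Z_range by (auto simp: compactin_subtopology)
  ultimately have comp: "compactin weak_topology (inv J ` Z)" by (rule image_compactin[rotated])
  have "weak_topology closure_of A \<subseteq> inv J ` Z"
  proof
    fix x assume "x \<in> weak_topology closure_of A"
    then have "J x \<in> Z"
      using continuous_map_image_closure_subset[OF contJ, of A] by (auto simp: Z_def)
    then show "x \<in> inv J ` Z" using injJ by (metis image_eqI inv_f_f)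
  qed
  then show ?thesis
    unfolding relatively_weakly_compact_def using closed_compactin[OF comp] by simp
qed

section \<open>The norm of the adjoint and the image of the unit ball\<close>

section \<open>Operators out of a Banach space\<close>

text \<open>Writing the zero vector as \<open>x - x\<close>, the triangle inequality gives that 0 is
  at most twice the norm of \<open>x\<close>.\<close>

lemma (in banach_str) vnorm_nonneg:
  assumes x: "x \<in> vcarrier Y"
  shows "0 \<le> vnorm Y x"
proof -
  have "0 = vnorm Y (vscale Y (1 + -1) x)" using norm_scale[OF x, of 0] by simp
  also have "\<dots> = vnorm Y (vadd Y (vscale Y 1 x) (vscale Y (-1) x))"
    using scale_add_left[OF x, of 1 "-1"] by simp
  also have "\<dots> \<le> vnorm Y (vscale Y 1 x) + vnorm Y (vscale Y (-1) x)"
    by (intro norm_triangle scale_closed x)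
  also have "\<dots> = 2 * vnorm Y x" using norm_scale[OF x, of 1] norm_scale[OF x, of "-1"] by simp
  finally show ?thesis by simp
qed

lemma (in banach_str) operator_from_bound:
  assumes "operator_from Y T"
  obtains K where "\<And>y. y \<in> unit_ball Y \<Longrightarrow> norm (T y) \<le> K"
proof -
  obtain K where K: "\<And>y. y \<in> vcarrier Y \<Longrightarrow> norm (T y) \<le> K * vnorm Y y"
    using assms unfolding operator_from_def by blast
  \<comment> \<open>The constant \<open>K\<close> may be negative when the space is trivial, so its
    absolute value is taken before the norm of \<open>y\<close> is replaced by 1.\<close>
  have "norm (T y) \<le> \<bar>K\<bar>" if "y \<in> unit_ball Y" for y
  proof -
    have y: "y \<in> vcarrier Y" "vnorm Y y \<le> 1" using that by (auto simp: unit_ball_def)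
    have "norm (T y) \<le> K * vnorm Y y" by (rule K[OF y(1)])
    also have "\<dots> \<le> \<bar>K\<bar> * vnorm Y y" using vnorm_nonneg[OF y(1)] by (intro mult_right_mono) auto
    also have "\<dots> \<le> \<bar>K\<bar> * 1" using y(2) by (intro mult_left_mono) auto
    finally show ?thesis by simp
  qed
  then show ?thesis by (rule that)
qed

lemma vnorm_adjoint_op:
  "vnorm (dual_str Y) (adjoint_op Y T f) = (SUP y\<in>unit_ball Y. \<bar>blinfun_apply f (T y)\<bar>)"
  unfolding dual_str_def by (auto simp: adjoint_op_def unit_ball_def intro: SUP_cong)

text \<open>A real supremum is known to dominate its members once the family is bounded above;
  boundedness of \<open>T\<close> on the unit ball provides this.\<close>

lemma (in banach_str) abs_le_vnorm_adjoint_op: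
  assumes T: "operator_from Y T" and y: "y \<in> unit_ball Y"
  shows "\<bar>blinfun_apply f (T y)\<bar> \<le> vnorm (dual_str Y) (adjoint_op Y T f)"
proof -
  obtain K where K: "\<And>y. y \<in> unit_ball Y \<Longrightarrow> norm (T y) \<le> K"
    using operator_from_bound[OF T] by blast
  have "bdd_above ((\<lambda>y. \<bar>blinfun_apply f (T y)\<bar>) ` unit_ball Y)"
  proof (rule bdd_aboveI2)
    fix y assume "y \<in> unit_ball Y"
    then show "\<bar>blinfun_apply f (T y)\<bar> \<le> norm f * K"
      using norm_blinfun[of f "T y"] mult_left_mono[OF K norm_ge_zero[of f]] by fastforce
  qed
  then show ?thesis unfolding vnorm_adjoint_op using y by (rule cSUP_upper[rotated])
qed

lemma (in banach_str) weakly_p_DP_set_image_unit_ball: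
  assumes T: "operator_from Y T" and conv: "p_convergent p (dual_str Y) (adjoint_op Y T)"
  shows "weakly_p_DP_set p (T ` unit_ball Y)"
  unfolding weakly_p_DP_set_def
proof (intro conjI allI impI)
  show "bounded (T ` unit_ball Y)"
    using operator_from_bound[OF T] unfolding bounded_iff by (metis imageE)
  fix f :: "nat \<Rightarrow> ('b \<Rightarrow>\<^sub>L real)" assume "weakly_p_summable p f"
  then have "(\<lambda>n. vnorm (dual_str Y) (adjoint_op Y T (f n))) \<longlonglongrightarrow> 0"
    using conv by (simp add: p_convergent_def)
  then have lim: "(\<lambda>n. ennreal (vnorm (dual_str Y) (adjoint_op Y T (f n)))) \<longlonglongrightarrow> 0"
    using tendsto_ennrealI by fastforce
  show "(\<lambda>n. SUP x\<in>T ` unit_ball Y. ennreal \<bar>blinfun_apply (f n) x\<bar>) \<longlonglongrightarrow> 0"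
  proof (rule tendsto_sandwich[OF _ _ tendsto_const lim])
    show "\<forall>\<^sub>F n in sequentially. (SUP x\<in>T ` unit_ball Y. ennreal \<bar>blinfun_apply (f n) x\<bar>)
        \<le> ennreal (vnorm (dual_str Y) (adjoint_op Y T (f n)))"
      using abs_le_vnorm_adjoint_op[OF T] by (intro always_eventually allI SUP_least) (auto intro: ennreal_leI)
  qed simp
qed

section \<open>Isometric copies of a Banach space inside another type\<close>

section \<open>Transport along an injection\<close>

text \<open>The spaces in (i) have their points in \<open>'y\<close>, whereas \<open>ell1\<close>
  lives on sequences. Passing from (i) to (ii) therefore goes through a copy of \<open>ell1\<close>
  in \<open>'y\<close>.\<close>

definition transport_str :: "('a \<Rightarrow> 'y) \<Rightarrow> 'a normed_str \<Rightarrow> 'y normed_str" where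
  "transport_str e E =
    \<lparr>vcarrier = e ` vcarrier E,
     vadd = (\<lambda>x y. e (vadd E (inv e x) (inv e y))),
     vzero = e (vzero E),
     vscale = (\<lambda>r x. e (vscale E r (inv e x))),
     vnorm = (\<lambda>x. vnorm E (inv e x))\<rparr>"

lemma transport_str_simps:
  assumes "inj e"
  shows "vcarrier (transport_str e E) = e ` vcarrier E"
    and "vadd (transport_str e E) (e x) (e y) = e (vadd E x y)"
    and "vzero (transport_str e E) = e (vzero E)"
    and "vscale (transport_str e E) r (e x) = e (vscale E r x)"
    and "vnorm (transport_str e E) (e x) = vnorm E x"
    and "unit_ball (transport_str e E) = e ` unit_ball E"
    and "vdist (transport_str e E) (e x) (e y) = vdist E x y"
  using assms by (auto simp: transport_str_def unit_ball_def vdist_def inj_image_mem_iff)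

lemma (in banach_str) Metric_space_vdist: "Metric_space (vcarrier Y) (vdist Y)"
proof
  have neg: "vscale Y (-1) (vadd Y x (vscale Y (-1) y)) = vadd Y y (vscale Y (-1) x)"
    if "x \<in> vcarrier Y" "y \<in> vcarrier Y" for x y
    using that by (simp add: scale_add_right scale_closed scale_scale scale_one add_commute)
  have scale_0: "vadd Y x (vscale Y (-1) x) = vzero Y" if x: "x \<in> vcarrier Y" for x
    using scale_add_left[OF x, of 1 "-1"] norm_scale[OF x, of 0] norm_eq_zero[OF scale_closed[OF x, of 0]]
    by (simp add: scale_one[OF x])
  have zero_add: "vadd Y (vzero Y) x = x" if x: "x \<in> vcarrier Y" for x
    using add_commute[OF zero_closed x] add_zero[OF x] by simp
  have cancel: "vadd Y (vadd Y x (vscale Y (-1) y)) y = x" if "x \<in> vcarrier Y" "y \<in> vcarrier Y" for x y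
    using that scale_0[of y] add_commute[of y "vscale Y (-1) y"]
    by (simp add: add_assoc scale_closed add_zero)
  show "0 \<le> vdist Y x y" for x y
    by (simp add: vdist_def vnorm_nonneg add_closed scale_closed)
  show "vdist Y x y = vdist Y y x" for x y
    using neg[of x y] norm_scale[of "vadd Y x (vscale Y (-1) y)" "-1"]
    by (auto simp: vdist_def add_closed scale_closed)
  show "vdist Y x y = 0 \<longleftrightarrow> x = y" if "x \<in> vcarrier Y" "y \<in> vcarrier Y" for x y
  proof
    assume "vdist Y x y = 0"
    then have "vadd Y x (vscale Y (-1) y) = vzero Y"
      using that by (simp add: vdist_def norm_eq_zero add_closed scale_closed)
    then show "x = y" using cancel[OF that] zero_add[OF that(2)] by simp
  next
    assume "x = y"
    then show "vdist Y x y = 0"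
      using that by (simp add: vdist_def scale_0 norm_eq_zero zero_closed)
  qed
  show "vdist Y x z \<le> vdist Y x y + vdist Y y z"
    if "x \<in> vcarrier Y" "y \<in> vcarrier Y" "z \<in> vcarrier Y" for x y z
  proof -
    have "vadd Y x (vscale Y (-1) z)
        = vadd Y (vadd Y (vadd Y x (vscale Y (-1) y)) y) (vscale Y (-1) z)"
      using cancel[OF that(1,2)] by simp
    also have "\<dots> = vadd Y (vadd Y x (vscale Y (-1) y)) (vadd Y y (vscale Y (-1) z))"
      using that by (intro add_assoc) (simp_all add: add_closed scale_closed)
    finally show ?thesis
      using that by (simp add: vdist_def norm_triangle add_closed scale_closed)
  qed
qed

text \<open>The algebraic and norm axioms carry over point by point. For completeness a Cauchy
  sequence is pulled back along \<open>inv e\<close>, and the image of its limit is the limit in the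
  copy.\<close>

lemma banach_str_transport:
  assumes E: "banach_str E" and e: "inj e"
  shows "banach_str (transport_str e E)"
proof -
  interpret E: banach_str E by fact
  interpret E: Metric_space "vcarrier E" "vdist E" by (rule E.Metric_space_vdist)
  let ?Y = "transport_str e E"
  note simps = transport_str_simps[OF e]
  interpret Y: Metric_space "vcarrier ?Y" "vdist ?Y"
  proof
    have cases: "vdist ?Y x y = 0 \<or> (\<exists>a b. a \<in> vcarrier E \<and> b \<in> vcarrier E \<and> x = e a \<and> y = e b)" for x y
      by (auto simp: vdist_def simps(1))
    show "0 \<le> vdist ?Y x y" for x y
      using cases[of x y] by (auto simp: simps E.nonneg)
    show "vdist ?Y x y = vdist ?Y y x" for x y
    proof (cases "x \<in> vcarrier ?Y \<and> y \<in> vcarrier ?Y")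
      case True
      then show ?thesis by (auto simp: simps E.commute)
    qed (auto simp: vdist_def)
    show "vdist ?Y x y = 0 \<longleftrightarrow> x = y" if "x \<in> vcarrier ?Y" "y \<in> vcarrier ?Y" for x y
      using that e by (auto simp: simps inj_eq)
    show "vdist ?Y x z \<le> vdist ?Y x y + vdist ?Y y z"
      if "x \<in> vcarrier ?Y" "y \<in> vcarrier ?Y" "z \<in> vcarrier ?Y" for x y z
      using that by (auto simp: simps intro: E.triangle)
  qed
  have complete: "Y.mcomplete"
    unfolding Y.mcomplete_def
  proof (intro allI impI)
    fix \<sigma> assume \<sigma>: "Y.MCauchy \<sigma>"
    define \<tau> where "\<tau> n = inv e (\<sigma> n)" for n
    have \<tau>: "\<sigma> n = e (\<tau> n)" "\<tau> n \<in> vcarrier E" for n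
    proof -
      have "\<sigma> n \<in> vcarrier ?Y" using \<sigma> unfolding Y.MCauchy_def by blast
      then have "\<sigma> n \<in> e ` vcarrier E" by (simp add: simps)
      then show "\<sigma> n = e (\<tau> n)" "\<tau> n \<in> vcarrier E" using e by (auto simp: \<tau>_def)
    qed
    have "E.MCauchy \<tau>"
      using \<sigma> \<tau>(2) unfolding Y.MCauchy_def E.MCauchy_def by (auto simp: \<tau>(1) simps)
    then obtain l where l: "limitin E.mtopology \<tau> l sequentially"
      using E.complete by (auto simp: E.mcomplete_def)
    then have "limitin Y.mtopology \<sigma> (e l) sequentially"
      unfolding E.limit_metric_sequentially Y.limit_metric_sequentially using e
      by (auto simp: simps \<tau>(1) inj_image_mem_iff)
    then show "\<exists>l. limitin Y.mtopology \<sigma> l sequentially" ..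
  qed
  show ?thesis
  proof
    show "\<exists>y\<in>vcarrier ?Y. vadd ?Y x y = vzero ?Y" if "x \<in> vcarrier ?Y" for x
    proof -
      from that obtain a where a: "a \<in> vcarrier E" "x = e a" by (auto simp: simps)
      obtain b where "b \<in> vcarrier E" "vadd E a b = vzero E" using E.add_inverse[OF a(1)] by blast
      then show ?thesis using a(2) by (intro bexI[of _ "e b"]) (simp_all add: simps)
    qed
    show "Y.mcomplete" by (rule complete)
  qed (use e in \<open>auto simp: simps inj_eq E.zero_closed E.add_closed E.scale_closed E.add_assoc E.add_zero
      E.scale_add_right E.scale_add_left E.scale_scale E.scale_one E.norm_eq_zero E.norm_scale E.norm_triangle
      intro: E.add_commute\<close>)
qed

lemma operator_from_transport:
  assumes "inj e" "operator_from E T"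
  shows "operator_from (transport_str e E) (T \<circ> inv e)"
  using assms by (auto simp: operator_from_def transport_str_simps)

lemma image_unit_ball_transport:
  assumes "inj e"
  shows "(T \<circ> inv e) ` unit_ball (transport_str e E) = T ` unit_ball E"
  using assms by (simp add: transport_str_simps image_image)

text \<open>By \<open>vnorm_adjoint_op\<close> the norm of an adjoint depends only on the image of
  the unit ball, which is the same for the copy.\<close>

lemma p_convergent_adjoint_op_transport:
  assumes "inj e"
  shows "p_convergent p (dual_str (transport_str e E)) (adjoint_op (transport_str e E) (T \<circ> inv e))
    \<longleftrightarrow> p_convergent p (dual_str E) (adjoint_op E T)"
  using assms by (simp add: p_convergent_def vnorm_adjoint_op transport_str_simps image_image)

section \<open>The Banach space axioms for \<open>ell1\<close>, chiefly completeness\<close>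

section \<open>The space \<open>\<ell>\<^sub>1\<close>\<close>

lemma ell1_simps [simp]:
  "a \<in> vcarrier ell1 \<longleftrightarrow> summable (\<lambda>n. \<bar>a n\<bar>)"
  "vadd ell1 a b = (\<lambda>n. a n + b n)"
  "vzero ell1 = (\<lambda>n. 0)"
  "vscale ell1 r a = (\<lambda>n. r * a n)"
  "vnorm ell1 a = (\<Sum>n. \<bar>a n\<bar>)"
  by (simp_all add: ell1_def)

lemma summable_abs_add:
  fixes a b :: "nat \<Rightarrow> real"
  assumes "summable (\<lambda>n. \<bar>a n\<bar>)" "summable (\<lambda>n. \<bar>b n\<bar>)"
  shows "summable (\<lambda>n. \<bar>a n + b n\<bar>)" "(\<Sum>n. \<bar>a n + b n\<bar>) \<le> (\<Sum>n. \<bar>a n\<bar>) + (\<Sum>n. \<bar>b n\<bar>)"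
proof -
  have sum: "summable (\<lambda>n. \<bar>a n\<bar> + \<bar>b n\<bar>)" using assms by (rule summable_add)
  show s: "summable (\<lambda>n. \<bar>a n + b n\<bar>)"
    by (rule summable_comparison_test'[OF sum, of 0]) (simp add: abs_triangle_ineq)
  have "(\<Sum>n. \<bar>a n + b n\<bar>) \<le> (\<Sum>n. \<bar>a n\<bar> + \<bar>b n\<bar>)"
    using s sum by (intro suminf_le abs_triangle_ineq)
  then show "(\<Sum>n. \<bar>a n + b n\<bar>) \<le> (\<Sum>n. \<bar>a n\<bar>) + (\<Sum>n. \<bar>b n\<bar>)"
    using suminf_add[OF assms] by simp
qed

lemma summable_abs_scale:
  fixes a :: "nat \<Rightarrow> real"
  assumes "summable (\<lambda>n. \<bar>a n\<bar>)"
  shows "summable (\<lambda>n. \<bar>r * a n\<bar>)" "(\<Sum>n. \<bar>r * a n\<bar>) = \<bar>r\<bar> * (\<Sum>n. \<bar>a n\<bar>)"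
  using summable_mult[OF assms, of "\<bar>r\<bar>"] suminf_mult[OF assms, of "\<bar>r\<bar>"] by (simp_all add: abs_mult)

lemma summable_abs_diff:
  fixes a b :: "nat \<Rightarrow> real"
  assumes "summable (\<lambda>n. \<bar>a n\<bar>)" "summable (\<lambda>n. \<bar>b n\<bar>)"
  shows "summable (\<lambda>n. \<bar>a n - b n\<bar>)"
  using summable_abs_add(1)[OF assms(1) summable_abs_scale(1)[OF assms(2), of "-1"]] by simp

lemma suminf_abs_eq_0_iff:
  fixes a :: "nat \<Rightarrow> real"
  assumes "summable (\<lambda>n. \<bar>a n\<bar>)"
  shows "(\<Sum>n. \<bar>a n\<bar>) = 0 \<longleftrightarrow> a = (\<lambda>n. 0)"
  using suminf_eq_zero_iff[OF assms] by auto

lemma vdist_ell1: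
  assumes "summable (\<lambda>n. \<bar>a n\<bar>)" "summable (\<lambda>n. \<bar>b n\<bar>)"
  shows "vdist ell1 a b = (\<Sum>n. \<bar>a n - b n\<bar>)"
  using assms by (simp add: vdist_def)

text \<open>\<open>Metric_space_vdist\<close> presupposes \<open>banach_str\<close>, and with it the
  completeness still to be shown for \<open>ell1\<close>; the metric axioms are therefore checked
  directly.\<close>

lemma Metric_space_ell1: "Metric_space (vcarrier ell1) (vdist ell1)"
proof
  show "0 \<le> vdist ell1 a b" for a b
    using suminf_nonneg[OF summable_abs_diff[of a b]] by (auto simp: vdist_def)
  show "vdist ell1 a b = vdist ell1 b a" for a b
    by (simp add: vdist_def abs_minus_commute)
  show "vdist ell1 a b = 0 \<longleftrightarrow> a = b" if "a \<in> vcarrier ell1" "b \<in> vcarrier ell1" for a b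
    using that suminf_abs_eq_0_iff[OF summable_abs_diff[of a b]] by (auto simp: vdist_ell1 fun_eq_iff)
  show "vdist ell1 a c \<le> vdist ell1 a b + vdist ell1 b c"
    if "a \<in> vcarrier ell1" "b \<in> vcarrier ell1" "c \<in> vcarrier ell1" for a b c
    using that summable_abs_add(2)[OF summable_abs_diff[of a b] summable_abs_diff[of b c]]
    by (simp add: vdist_ell1)
qed

interpretation ell1: Metric_space "vcarrier ell1" "vdist ell1"
  by (rule Metric_space_ell1)

text \<open>A Cauchy sequence converges in each coordinate. Its Cauchy estimates, restricted to
  finitely many coordinates, survive the limit and then extend to the full sum.\<close>

lemma mcomplete_ell1: "ell1.mcomplete"
  unfolding ell1.mcomplete_def
proof (intro allI impI)
  fix \<sigma> assume \<sigma>: "ell1.MCauchy \<sigma>"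
  then have "\<sigma> n \<in> vcarrier ell1" for n unfolding ell1.MCauchy_def by blast
  then have sum: "summable (\<lambda>k. \<bar>\<sigma> n k\<bar>)" for n by simp
  have Cauchy: "\<exists>N. \<forall>m\<ge>N. \<forall>n\<ge>N. (\<Sum>k. \<bar>\<sigma> m k - \<sigma> n k\<bar>) < e" if "e > 0" for e
  proof -
    have "\<exists>N. \<forall>m n. N \<le> m \<longrightarrow> N \<le> n \<longrightarrow> vdist ell1 (\<sigma> m) (\<sigma> n) < e"
      using \<sigma> that unfolding ell1.MCauchy_def by (elim conjE allE[of _ e]) (rule mp)
    then show ?thesis by (simp add: vdist_ell1[OF sum sum])
  qed
  have partial: "(\<Sum>k<i. \<bar>\<sigma> m k - \<sigma> n k\<bar>) \<le> (\<Sum>k. \<bar>\<sigma> m k - \<sigma> n k\<bar>)" for i m n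
    using summable_abs_diff[OF sum sum] by (intro sum_le_suminf) auto
  have "convergent (\<lambda>n. \<sigma> n k)" for k
  proof -
    have coord: "\<bar>\<sigma> m k - \<sigma> n k\<bar> \<le> (\<Sum>k. \<bar>\<sigma> m k - \<sigma> n k\<bar>)" for m n
      using sum_le_suminf[OF summable_abs_diff[OF sum[of m] sum[of n]], of "{k}"] by simp
    have "Cauchy (\<lambda>n. \<sigma> n k)"
    proof (rule CauchyI)
      fix e :: real assume "0 < e"
      from Cauchy[OF this] obtain N where N: "\<forall>m\<ge>N. \<forall>n\<ge>N. (\<Sum>k. \<bar>\<sigma> m k - \<sigma> n k\<bar>) < e" ..
      have "norm (\<sigma> m k - \<sigma> n k) < e" if "N \<le> m" "N \<le> n" for m n
      proof -
        have "(\<Sum>k. \<bar>\<sigma> m k - \<sigma> n k\<bar>) < e" using N that by blast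
        with coord[of m n] show ?thesis by simp
      qed
      then show "\<exists>M. \<forall>m\<ge>M. \<forall>n\<ge>M. norm (\<sigma> m k - \<sigma> n k) < e" by blast
    qed
    then show ?thesis by (rule Cauchy_convergent)
  qed
  then obtain l where l: "\<And>k. (\<lambda>n. \<sigma> n k) \<longlonglongrightarrow> l k" unfolding convergent_def by metis
  have close: "\<exists>N. \<forall>n\<ge>N. summable (\<lambda>k. \<bar>\<sigma> n k - l k\<bar>) \<and> (\<Sum>k. \<bar>\<sigma> n k - l k\<bar>) < e" if e: "e > 0" for e
  proof -
    obtain N where N: "\<And>m n. m \<ge> N \<Longrightarrow> n \<ge> N \<Longrightarrow> (\<Sum>k. \<bar>\<sigma> m k - \<sigma> n k\<bar>) < e / 2"
      using Cauchy[of "e / 2"] e half_gt_zero by blast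
    \<comment> \<open>For a fixed number \<open>i\<close> of coordinates the limit in
      \<open>m\<close> may be taken term by term. The bound does not depend on \<open>i\<close>, and
      \<open>e / 2\<close> leaves room for the strict inequality.\<close>
    have bound: "(\<Sum>k<i. \<bar>\<sigma> n k - l k\<bar>) \<le> e / 2" if n: "n \<ge> N" for n i
    proof (rule tendsto_upperbound)
      show "(\<lambda>m. \<Sum>k<i. \<bar>\<sigma> n k - \<sigma> m k\<bar>) \<longlonglongrightarrow> (\<Sum>k<i. \<bar>\<sigma> n k - l k\<bar>)"
        by (intro tendsto_intros l)
      show "\<forall>\<^sub>F m in sequentially. (\<Sum>k<i. \<bar>\<sigma> n k - \<sigma> m k\<bar>) \<le> e / 2"
        unfolding eventually_sequentially
      proof (intro exI[of _ N] allI impI)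
        fix m assume "N \<le> m"
        then show "(\<Sum>k<i. \<bar>\<sigma> n k - \<sigma> m k\<bar>) \<le> e / 2"
          using N[OF n, of m] partial[where i = i and m = n and n = m] by linarith
      qed
    qed simp
    show ?thesis
    proof (intro exI[of _ N] allI impI conjI)
      fix n assume n: "N \<le> n"
      show sum_diff: "summable (\<lambda>k. \<bar>\<sigma> n k - l k\<bar>)"
        by (rule summableI_nonneg_bounded[OF abs_ge_zero bound[OF n]])
      have "(\<Sum>k. \<bar>\<sigma> n k - l k\<bar>) \<le> e / 2" by (rule suminf_le_const[OF sum_diff bound[OF n]])
      then show "(\<Sum>k. \<bar>\<sigma> n k - l k\<bar>) < e" using e by simp
    qed
  qed
  \<comment> \<open>The limit is summable as the difference of \<open>\<sigma> N\<close> and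
    \<open>\<sigma> N - l\<close>.\<close>
  obtain N where "summable (\<lambda>k. \<bar>\<sigma> N k - l k\<bar>)" using close[of 1] by auto
  from summable_abs_diff[OF sum[of N] this] have suml: "summable (\<lambda>k. \<bar>l k\<bar>)" by simp
  have "limitin ell1.mtopology \<sigma> l sequentially"
    unfolding ell1.limit_metric_sequentially
  proof (intro conjI allI impI)
    show "l \<in> vcarrier ell1" using suml by simp
    fix e :: real assume "0 < e"
    from close[OF this] obtain N where "\<forall>n\<ge>N. summable (\<lambda>k. \<bar>\<sigma> n k - l k\<bar>) \<and> (\<Sum>k. \<bar>\<sigma> n k - l k\<bar>) < e" ..
    then show "\<exists>N. \<forall>n\<ge>N. \<sigma> n \<in> vcarrier ell1 \<and> vdist ell1 (\<sigma> n) l < e"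
      by (intro exI[of _ N]) (simp add: sum vdist_ell1[OF sum suml])
  qed
  then show "\<exists>l. limitin ell1.mtopology \<sigma> l sequentially" by (intro exI)
qed

lemma banach_str_ell1: "banach_str ell1"
proof
  show "\<exists>y\<in>vcarrier ell1. vadd ell1 x y = vzero ell1" if "x \<in> vcarrier ell1" for x
    using that by (intro bexI[of _ "\<lambda>n. - x n"]) auto
  show "ell1.mcomplete" by (rule mcomplete_ell1)
qed (auto simp: summable_abs_add summable_abs_scale suminf_abs_eq_0_iff algebra_simps)

section \<open>Operators on \<open>ell1\<close> with prescribed values at the unit vectors\<close>

section \<open>Operators defined by bounded sequences\<close>

definition series_op :: "(nat \<Rightarrow> 'b::banach) \<Rightarrow> (nat \<Rightarrow> real) \<Rightarrow> 'b" where
  "series_op s a = (\<Sum>n. a n *\<^sub>R s n)"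

lemma series_op_sums:
  fixes s :: "nat \<Rightarrow> 'b::banach"
  assumes s: "\<And>n. norm (s n) \<le> K" and a: "summable (\<lambda>n. \<bar>a n\<bar>)"
  shows "(\<lambda>n. a n *\<^sub>R s n) sums series_op s a"
proof -
  have "summable (\<lambda>n. a n *\<^sub>R s n)"
  proof (rule summable_comparison_test'[OF summable_mult2[OF a, of K], of 0])
    show "norm (a n *\<^sub>R s n) \<le> \<bar>a n\<bar> * K" for n
      using s by (simp add: mult_left_mono)
  qed
  then show ?thesis unfolding series_op_def by (rule summable_sums)
qed

text \<open>The codomain of \<open>f\<close> is general for two uses: the identity gives the
  boundedness of \<open>series_op s\<close>, and real functionals give the estimate for its
  adjoint.\<close>

lemma series_op_bound:
  fixes s :: "nat \<Rightarrow> 'b::banach" and f :: "'b \<Rightarrow>\<^sub>L 'c::banach"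
  assumes s: "\<And>n. norm (s n) \<le> K" and f: "\<And>n. norm (blinfun_apply f (s n)) \<le> r"
    and a: "summable (\<lambda>n. \<bar>a n\<bar>)"
  shows "norm (blinfun_apply f (series_op s a)) \<le> r * (\<Sum>n. \<bar>a n\<bar>)"
proof -
  have "(\<lambda>n. blinfun_apply f (a n *\<^sub>R s n)) sums blinfun_apply f (series_op s a)"
    using series_op_sums[OF s a] by (rule bounded_linear.sums[OF blinfun.bounded_linear_right])
  then have sums: "(\<lambda>n. a n *\<^sub>R blinfun_apply f (s n)) sums blinfun_apply f (series_op s a)"
    by (simp add: blinfun.scaleR_right)
  have term_le: "norm (a n *\<^sub>R blinfun_apply f (s n)) \<le> r * \<bar>a n\<bar>" for n
    using mult_left_mono[OF f[of n] abs_ge_zero[of "a n"]] by (simp add: mult.commute)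
  have sum_r: "summable (\<lambda>n. r * \<bar>a n\<bar>)" using a by (rule summable_mult)
  have sum_norm: "summable (\<lambda>n. norm (a n *\<^sub>R blinfun_apply f (s n)))"
    by (rule summable_comparison_test'[OF sum_r, of 0]) (simp only: real_norm_def abs_norm_cancel term_le)
  have "norm (\<Sum>n. a n *\<^sub>R blinfun_apply f (s n)) \<le> (\<Sum>n. r * \<bar>a n\<bar>)"
    using summable_norm[OF sum_norm] suminf_le[OF term_le sum_norm sum_r] by (rule order_trans)
  then show ?thesis using sums_unique[OF sums] suminf_mult[OF a] by simp
qed

lemma operator_from_series_op:
  fixes s :: "nat \<Rightarrow> 'b::banach"
  assumes s: "\<And>n. norm (s n) \<le> K"
  shows "operator_from ell1 (series_op s)"
  unfolding operator_from_def
proof (intro conjI ballI allI exI)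
  fix a b :: "nat \<Rightarrow> real" assume ab: "a \<in> vcarrier ell1" "b \<in> vcarrier ell1"
  have "(\<lambda>n. a n *\<^sub>R s n + b n *\<^sub>R s n) sums (series_op s a + series_op s b)"
    using ab by (intro sums_add series_op_sums[OF s]) simp_all
  then show "series_op s (vadd ell1 a b) = series_op s a + series_op s b"
    unfolding series_op_def[of s "vadd ell1 a b"] by (simp add: sums_iff scaleR_left_distrib)
next
  fix r and a :: "nat \<Rightarrow> real" assume a: "a \<in> vcarrier ell1"
  have "(\<lambda>n. r *\<^sub>R (a n *\<^sub>R s n)) sums (r *\<^sub>R series_op s a)"
    using a by (intro sums_scaleR_right series_op_sums[OF s]) simp
  then show "series_op s (vscale ell1 r a) = r *\<^sub>R series_op s a"
    unfolding series_op_def[of s "vscale ell1 r a"] by (simp add: sums_iff)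
next
  fix a :: "nat \<Rightarrow> real" assume "a \<in> vcarrier ell1"
  then show "norm (series_op s a) \<le> K * vnorm ell1 a"
    using series_op_bound[where f = id_blinfun and r = K and a = a, OF s] s by simp
qed

lemma range_subset_series_op_unit_ball: "range s \<subseteq> series_op s ` unit_ball ell1"
proof clarify
  fix n
  define e :: "nat \<Rightarrow> real" where "e k = (if k = n then 1 else 0)" for k
  have "(\<lambda>k. \<bar>e k\<bar>) sums 1" using sums_If_finite_set[of "{n}" "\<lambda>_. 1::real"] by (simp add: e_def if_distrib cong: if_cong)
  then have "e \<in> unit_ball ell1" by (auto simp: unit_ball_def sums_iff)
  moreover have "series_op s e = s n"
  proof -
    have "(\<Sum>k. e k *\<^sub>R s k) = (\<Sum>k\<in>{n}. e k *\<^sub>R s k)" by (rule suminf_finite) (auto simp: e_def)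
    then show ?thesis by (simp add: series_op_def e_def)
  qed
  ultimately show "s n \<in> series_op s ` unit_ball ell1" by force
qed

lemma p_convergent_adjoint_series_op:
  fixes s :: "nat \<Rightarrow> 'b::banach"
  assumes A: "weakly_p_DP_set p A" and s: "range s \<subseteq> A"
  shows "p_convergent p (dual_str ell1) (adjoint_op ell1 (series_op s))"
  unfolding p_convergent_def
proof (intro allI impI)
  interpret banach_str "ell1" by (rule banach_str_ell1)
  have "bounded (range s)" using A s bounded_subset by (auto simp: weakly_p_DP_set_def)
  then obtain K where K: "\<And>n. norm (s n) \<le> K" by (auto simp: bounded_iff)
  note T = operator_from_series_op[OF K]
  \<comment> \<open>The unit ball is nonempty, which yields both nonnegativity of the adjoint norm
    and the least-upper-bound rule for its real supremum.\<close>
  have zero: "(\<lambda>n. 0) \<in> unit_ball ell1" by (simp add: unit_ball_def)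
  fix f :: "nat \<Rightarrow> ('b \<Rightarrow>\<^sub>L real)" assume "weakly_p_summable p f"
  then have lim: "(\<lambda>n. SUP x\<in>A. ennreal \<bar>blinfun_apply (f n) x\<bar>) \<longlonglongrightarrow> 0"
    using A by (simp add: weakly_p_DP_set_def)
  have nonneg: "0 \<le> vnorm (dual_str ell1) (adjoint_op ell1 (series_op s) (f n))" for n
    using abs_le_vnorm_adjoint_op[OF T zero] abs_ge_zero by (rule order_trans[rotated])
  show "(\<lambda>n. vnorm (dual_str ell1) (adjoint_op ell1 (series_op s) (f n))) \<longlonglongrightarrow> 0"
  proof (rule LIMSEQ_I)
    fix e :: real assume e: "0 < e"
    then have "\<forall>\<^sub>F n in sequentially. (SUP x\<in>A. ennreal \<bar>blinfun_apply (f n) x\<bar>) < ennreal (e / 2)"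
      using order_tendstoD(2)[OF lim] by simp
    then obtain N where N: "\<And>n. n \<ge> N \<Longrightarrow> (SUP x\<in>A. ennreal \<bar>blinfun_apply (f n) x\<bar>) < ennreal (e / 2)"
      unfolding eventually_sequentially by blast
    have "norm (vnorm (dual_str ell1) (adjoint_op ell1 (series_op s) (f n)) - 0) < e" if n: "n \<ge> N" for n
    proof -
      have fs: "\<bar>blinfun_apply (f n) (s k)\<bar> \<le> e / 2" for k
      proof -
        have "ennreal \<bar>blinfun_apply (f n) (s k)\<bar> \<le> (SUP x\<in>A. ennreal \<bar>blinfun_apply (f n) x\<bar>)"
          using s by (intro SUP_upper) auto
        also have "\<dots> < ennreal (e / 2)" by (rule N[OF n])
        finally show ?thesis using e by (simp add: ennreal_less_iff)
      qed
      have "vnorm (dual_str ell1) (adjoint_op ell1 (series_op s) (f n)) \<le> e / 2"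
        unfolding vnorm_adjoint_op
      proof (rule cSUP_least)
        fix a assume a: "a \<in> unit_ball ell1"
        then have "\<bar>blinfun_apply (f n) (series_op s a)\<bar> \<le> e / 2 * (\<Sum>n. \<bar>a n\<bar>)"
          using series_op_bound[where f = "f n" and r = "e / 2" and a = a, OF K] fs by (simp add: unit_ball_def)
        also have "\<dots> \<le> e / 2 * 1"
          using a e by (intro mult_left_mono) (auto simp: unit_ball_def)
        finally show "\<bar>blinfun_apply (f n) (series_op s a)\<bar> \<le> e / 2" by simp
      qed (use zero in blast)
      then show ?thesis using nonneg[of n] e by simp
    qed
    then show "\<exists>N. \<forall>n\<ge>N. norm (vnorm (dual_str ell1) (adjoint_op ell1 (series_op s) (f n)) - 0) < e"
      by blast
  qed
qed

section \<open>The cycle of implications and its three instances\<close>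

section \<open>The equivalences for a sequentially determined property\<close>

text \<open>The cycle is (i) to (ii) by the copy of \<open>ell1\<close>, (ii) to (iii) by
  \<open>series_op\<close>, and (iii) to (i) by the image of the unit ball. \<open>Q_seq\<close>
  speaks of a set \<open>C\<close> around the sequence because \<open>series_op\<close> yields the
  image of the whole unit ball, which contains the sequence and may leave \<open>A\<close>.\<close>

lemma operators_from_all_iff_ell1:
  fixes embed :: "(nat \<Rightarrow> real) \<Rightarrow> 'y" and Q :: "'x::banach set \<Rightarrow> bool"
  assumes embed: "inj embed"
    and Q_seq: "\<And>A. bounded A \<Longrightarrow> \<forall>s :: nat \<Rightarrow> 'x. range s \<subseteq> A \<longrightarrow> (\<exists>C. range s \<subseteq> C \<and> Q C) \<Longrightarrow> Q A"
  shows "((\<forall>Y :: 'y normed_str. banach_str Y \<longrightarrow>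
            (\<forall>T :: 'y \<Rightarrow> 'x. operator_from Y T \<and> p_convergent p (dual_str Y) (adjoint_op Y T)
               \<longrightarrow> Q (T ` unit_ball Y)))
          \<longleftrightarrow> (\<forall>T :: (nat \<Rightarrow> real) \<Rightarrow> 'x. operator_from ell1 T \<and> p_convergent p (dual_str ell1) (adjoint_op ell1 T)
               \<longrightarrow> Q (T ` unit_ball ell1)))
      \<and> ((\<forall>T :: (nat \<Rightarrow> real) \<Rightarrow> 'x. operator_from ell1 T \<and> p_convergent p (dual_str ell1) (adjoint_op ell1 T)
               \<longrightarrow> Q (T ` unit_ball ell1))
          \<longleftrightarrow> (\<forall>A. weakly_p_DP_set p A \<longrightarrow> Q A))"
    (is "(?all \<longleftrightarrow> ?ell1) \<and> (?ell1 \<longleftrightarrow> ?sets)")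
proof -
  have "?ell1" if all: ?all
  proof (intro allI impI, elim conjE)
    fix T :: "(nat \<Rightarrow> real) \<Rightarrow> 'x"
    assume "operator_from ell1 T" "p_convergent p (dual_str ell1) (adjoint_op ell1 T)"
    then have "Q ((T \<circ> inv embed) ` unit_ball (transport_str embed ell1))"
      using all banach_str_transport[OF banach_str_ell1 embed] operator_from_transport[OF embed]
        p_convergent_adjoint_op_transport[OF embed] by blast
    then show "Q (T ` unit_ball ell1)" by (simp only: image_unit_ball_transport[OF embed])
  qed
  moreover have "?sets" if ell1: ?ell1
  proof (intro allI impI)
    fix A :: "'x set" assume A: "weakly_p_DP_set p A"
    have bdd: "bounded A" using A by (simp add: weakly_p_DP_set_def)
    then show "Q A"
    proof (rule Q_seq, intro allI impI)
      fix s :: "nat \<Rightarrow> 'x" assume s: "range s \<subseteq> A"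
      have "bounded (range s)" using bdd s by (rule bounded_subset)
      then obtain K where "\<And>n. norm (s n) \<le> K" by (auto simp: bounded_iff)
      then have "operator_from ell1 (series_op s)" by (rule operator_from_series_op)
      then have "Q (series_op s ` unit_ball ell1)"
        using ell1 p_convergent_adjoint_series_op[OF A s] by blast
      then show "\<exists>C. range s \<subseteq> C \<and> Q C" using range_subset_series_op_unit_ball by blast
    qed
  qed
  moreover have ?all if ?sets
    using that banach_str.weakly_p_DP_set_image_unit_ball by blast
  ultimately show ?thesis by blast
qed

lemma weakly_precompact_sequential:
  fixes A :: "'x::real_normed_vector set"
  assumes "\<forall>s :: nat \<Rightarrow> 'x. range s \<subseteq> A \<longrightarrow> (\<exists>C. range s \<subseteq> C \<and> weakly_precompact C)"
  shows "weakly_precompact A"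
  unfolding weakly_precompact_def
proof (intro allI impI)
  fix s :: "nat \<Rightarrow> 'x" assume "\<forall>n. s n \<in> A"
  then have "range s \<subseteq> A" by blast
  then obtain C where C: "range s \<subseteq> C" "weakly_precompact C" using assms by blast
  have "\<forall>n. s n \<in> C" using C(1) by blast
  then show "\<exists>r. strict_mono r \<and> weakly_Cauchy (s \<circ> r)"
    using C(2) unfolding weakly_precompact_def by blast
qed

lemma relatively_weakly_compact_sequential:
  fixes A :: "'x::banach set"
  assumes "bounded A"
    and seq: "\<forall>s :: nat \<Rightarrow> 'x. range s \<subseteq> A \<longrightarrow> (\<exists>C. range s \<subseteq> C \<and> relatively_weakly_compact C)"
  shows "relatively_weakly_compact A"
  using assms(1)
proof (rule eberlein)
  fix s :: "nat \<Rightarrow> 'x" assume "range s \<subseteq> A"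
  then obtain C where C: "range s \<subseteq> C" "relatively_weakly_compact C" using seq by blast
  have "C \<subseteq> weak_topology closure_of C" by (rule closure_of_subset) simp
  with C show "\<exists>C. compactin weak_topology C \<and> range s \<subseteq> C"
    unfolding relatively_weakly_compact_def by blast
qed

text \<open>Subsequential limits may lie outside \<open>A\<close>. Hence the argument produces
  Cauchy subsequences, that is total boundedness, and completeness of the space makes the closure
  compact.\<close>

lemma relatively_compact_sequential:
  fixes A :: "'x::banach set"
  assumes seq: "\<forall>s :: nat \<Rightarrow> 'x. range s \<subseteq> A \<longrightarrow> (\<exists>C. range s \<subseteq> C \<and> relatively_compact C)"
  shows "relatively_compact A"
proof -
  have "Met_TC.mtotally_bounded A"
    unfolding Met_TC.mtotally_bounded_sequentially
  proof (intro conjI allI impI)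
    fix s :: "nat \<Rightarrow> 'x" assume "range s \<subseteq> A"
    then obtain C where C: "range s \<subseteq> C" "compact (closure C)"
      using seq unfolding relatively_compact_def by blast
    have "\<forall>n. s n \<in> closure C" using C(1) closure_subset by blast
    then obtain l r where "strict_mono r" "(s \<circ> r) \<longlonglongrightarrow> l"
      using C(2) unfolding compact_eq_seq_compact_metric seq_compact_def by blast
    then show "\<exists>r. strict_mono r \<and> Met_TC.MCauchy (s \<circ> r)"
      using LIMSEQ_imp_Cauchy by auto
  qed simp
  then have "compactin Met_TC.mtopology (Met_TC.mtopology closure_of A)"
    using Met_TC.mtotally_bounded_eq_compact_closure_of[of A] complete_UNIV by simp
  then show ?thesis by (simp add: relatively_compact_def)
qed

theorem theorem15:
  fixes p :: real
    and embed :: "(nat \<Rightarrow> real) \<Rightarrow> 'y"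
  assumes p: "1 \<le> p"
    \<comment> \<open>\<open>'x\<close> is the Banach space \<open>X\<close>; the Banach spaces \<open>Y\<close> have their points in \<open>'y\<close>,
        an arbitrary type large enough to contain a copy of \<open>\<ell>\<^sub>1\<close>\<close>
    and embed: "inj embed"
  shows
    "(let a_i = (\<forall>Y :: 'y normed_str. banach_str Y \<longrightarrow>
            (\<forall>T :: 'y \<Rightarrow> 'x::banach. operator_from Y T \<and> p_convergent p (dual_str Y) (adjoint_op Y T)
               \<longrightarrow> weakly_precompact_op Y T));
          a_ii = (\<forall>T :: (nat \<Rightarrow> real) \<Rightarrow> 'x::banach.
            operator_from ell1 T \<and> p_convergent p (dual_str ell1) (adjoint_op ell1 T)
               \<longrightarrow> weakly_precompact_op ell1 T);
          a_iii = (\<forall>A :: 'x::banach set. weakly_p_DP_set p A \<longrightarrow> weakly_precompact A)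
      in (a_i \<longleftrightarrow> a_ii) \<and> (a_ii \<longleftrightarrow> a_iii))
     \<and>
     (let b_i = (\<forall>Y :: 'y normed_str. banach_str Y \<longrightarrow>
            (\<forall>T :: 'y \<Rightarrow> 'x::banach. operator_from Y T \<and> p_convergent p (dual_str Y) (adjoint_op Y T)
               \<longrightarrow> weakly_compact_op Y T));
          b_ii = (\<forall>T :: (nat \<Rightarrow> real) \<Rightarrow> 'x::banach.
            operator_from ell1 T \<and> p_convergent p (dual_str ell1) (adjoint_op ell1 T)
               \<longrightarrow> weakly_compact_op ell1 T);
          b_iii = (\<forall>A :: 'x::banach set. weakly_p_DP_set p A \<longrightarrow> relatively_weakly_compact A)
      in (b_i \<longleftrightarrow> b_ii) \<and> (b_ii \<longleftrightarrow> b_iii))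
     \<and>
     (let c_i = (\<forall>Y :: 'y normed_str. banach_str Y \<longrightarrow>
            (\<forall>T :: 'y \<Rightarrow> 'x::banach. operator_from Y T \<and> p_convergent p (dual_str Y) (adjoint_op Y T)
               \<longrightarrow> compact_op Y T));
          c_ii = (\<forall>T :: (nat \<Rightarrow> real) \<Rightarrow> 'x::banach.
            operator_from ell1 T \<and> p_convergent p (dual_str ell1) (adjoint_op ell1 T)
               \<longrightarrow> compact_op ell1 T);
          c_iii = (\<forall>A :: 'x::banach set. weakly_p_DP_set p A \<longrightarrow> relatively_compact A)
      in (c_i \<longleftrightarrow> c_ii) \<and> (c_ii \<longleftrightarrow> c_iii))"
  unfolding Let_def weakly_precompact_op_def weakly_compact_op_def compact_op_def
  by (rule conjI[OF _ conjI],
      rule operators_from_all_iff_ell1[where Q = weakly_precompact, OF embed],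
      erule weakly_precompact_sequential,
      rule operators_from_all_iff_ell1[where Q = relatively_weakly_compact, OF embed],
      erule (1) relatively_weakly_compact_sequential,
      rule operators_from_all_iff_ell1[where Q = relatively_compact, OF embed],
      erule relatively_compact_sequential)

end
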